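(* Let $\mathcal{A}$ be a unital JB-algebra and let $A,B$ be positive invertible elements of $\mathcal{A}$. For any $0\le\lambda\le1$, $$A!_{\lambda}B\le A\#_{\lambda}B\le A\triangledown_{\lambda}B.$$
   Context: A Jordan algebra over $\mathbb{R}$ is a real vector space with a bilinear product $\circ$ satisfying $a\circ b=b\circ a$ and $(a^2\circ b)\circ a=a^2\circ(b\circ a)$. A JB-algebra is a Jordan algebra over $\mathbb{R}$ with a complete norm satisfying $\|A\circ B\|\le\|A\|\|B\|$, $\|A^2\|=\|A\|^2$ and $\|A^2\|\le\|A^2+B^2\|$. In a unital JB-algebra $\mathcal{A}$ with unit $I$: $A$ is invertible, with Jordan inverse $A^{-1}=B$, if $A\circ B=I$ and $A^2\circ B=A$; the spectrum is $\mathrm{Sp}(A)=\{\lambda\in\mathbb{R}: A-\lambda I \text{ is not invertible}\}$; $A$ is positive ($A\ge 0$) if $\mathrm{Sp}(A)\subset[0,\infty)$; $A\le B$ means $B-A\ge0$. For $f$ continuous on $\mathrm{Sp}(A)$, $f(A)$ is defined by the continuous functional calculus in the norm-closed (associative) JB-subalgebra generated by $A$ and $I$, which is isometrically isomorphic to $C(\mathrm{Sp}(A))$. The Jordan triple notation is $\{ABA\}:=2(A\circ B)\circ A-A^2\circ B$. For positive invertible $A,B\in\mathcal{A}$ and $0\le\lambda\le1$: the weighted harmonic mean is $A!_\lambda B=((1-\lambda)A^{-1}+\lambda B^{-1})^{-1}$; the weighted geometric mean is $A\#_\lambda B=\{A^{1/2}\{A^{-1/2}BA^{-1/2}\}^{\lambda}A^{1/2}\}$;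 the weighted arithmetic mean is $A\triangledown_\lambda B=(1-\lambda)A+\lambda B$. *)

theory Defs
  imports "HOL-Analysis.Analysis"
begin

class jordan_algebra = real_vector +
  fixes jprod :: "'a \<Rightarrow> 'a \<Rightarrow> 'a"  (infixl "\<circ>\<^sub>J" 70)
  assumes jprod_commute: "a \<circ>\<^sub>J b = b \<circ>\<^sub>J a"
    and jprod_add_left: "(a + b) \<circ>\<^sub>J c = a \<circ>\<^sub>J c + b \<circ>\<^sub>J c"
    and jprod_scaleR_left: "(r *\<^sub>R a) \<circ>\<^sub>J b = r *\<^sub>R (a \<circ>\<^sub>J b)"
    and jordan_identity: "((a \<circ>\<^sub>J a) \<circ>\<^sub>J b) \<circ>\<^sub>J a = (a \<circ>\<^sub>J a) \<circ>\<^sub>J (b \<circ>\<^sub>J a)"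

class jb_algebra = jordan_algebra + banach +
  assumes norm_jprod_le: "norm (a \<circ>\<^sub>J b) \<le> norm a * norm b"
    and norm_jsquare: "norm (a \<circ>\<^sub>J a) = (norm a)\<^sup>2"
    and norm_jsquare_le: "norm (a \<circ>\<^sub>J a) \<le> norm (a \<circ>\<^sub>J a + b \<circ>\<^sub>J b)"

class unital_jb_algebra = jb_algebra +
  fixes jone :: 'a  ("\<one>\<^sub>J")
  assumes jprod_jone_left: "\<one>\<^sub>J \<circ>\<^sub>J a = a"

definition is_jinverse :: "'a::unital_jb_algebra \<Rightarrow> 'a \<Rightarrow> bool" where
  "is_jinverse A B \<longleftrightarrow> A \<circ>\<^sub>J B = \<one>\<^sub>J \<and> (A \<circ>\<^sub>J A) \<circ>\<^sub>J B = A"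

definition jinvertible :: "'a::unital_jb_algebra \<Rightarrow> bool" where
  "jinvertible A \<longleftrightarrow> (\<exists>B. is_jinverse A B)"

definition jinverse :: "'a::unital_jb_algebra \<Rightarrow> 'a" where
  "jinverse A = (THE B. is_jinverse A B)"

definition jspectrum :: "'a::unital_jb_algebra \<Rightarrow> real set" where
  "jspectrum A = {\<mu>. \<not> jinvertible (A - \<mu> *\<^sub>R \<one>\<^sub>J)}"

definition jpositive :: "'a::unital_jb_algebra \<Rightarrow> bool" where
  "jpositive A \<longleftrightarrow> jspectrum A \<subseteq> {0..}"

definition jle :: "'a::unital_jb_algebra \<Rightarrow> 'a \<Rightarrow> bool"  (infix "\<le>\<^sub>J" 50) where
  "A \<le>\<^sub>J B \<longleftrightarrow> jpositive (B - A)"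

text \<open>The triple product \<open>{ABA}\<close>.\<close>

definition jtriple :: "'a::jordan_algebra \<Rightarrow> 'a \<Rightarrow> 'a" where
  "jtriple A B = 2 *\<^sub>R ((A \<circ>\<^sub>J B) \<circ>\<^sub>J A) - (A \<circ>\<^sub>J A) \<circ>\<^sub>J B"

definition closed_jsubalgebra :: "'a::jb_algebra set \<Rightarrow> bool" where
  "closed_jsubalgebra S \<longleftrightarrow>
     subspace S \<and> closed S \<and> (\<forall>a\<in>S. \<forall>b\<in>S. a \<circ>\<^sub>J b \<in> S)"

text \<open>
  \<open>\<Phi>\<close> is an isometric isomorphism from \<open>C(Sp A)\<close> onto the closed subalgebra generated by \<open>A\<close>
  and the unit, sending the identity function to \<open>A\<close>. Elements of \<open>C(Sp A)\<close> are represented by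
  total functions that are continuous on the spectrum; the isometry condition forces \<open>\<Phi> f\<close> to
  depend only on the restriction of \<open>f\<close> to the spectrum.
\<close>

definition is_functional_calculus ::
    "'a::unital_jb_algebra \<Rightarrow> ((real \<Rightarrow> real) \<Rightarrow> 'a) \<Rightarrow> bool" where
  "is_functional_calculus A \<Phi> \<longleftrightarrow>
     (let C = {f. continuous_on (jspectrum A) f} in
        \<Phi> (\<lambda>x. x) = A \<and> \<Phi> (\<lambda>x. 1) = \<one>\<^sub>J \<and>
        (\<forall>f\<in>C. \<forall>g\<in>C. \<Phi> (\<lambda>x. f x + g x) = \<Phi> f + \<Phi> g) \<and>
        (\<forall>c. \<forall>f\<in>C. \<Phi> (\<lambda>x. c * f x) = c *\<^sub>R \<Phi> f) \<and>
        (\<forall>f\<in>C. \<forall>g\<in>C. \<Phi> (\<lambda>x. f x * g x) = \<Phi> f \<circ>\<^sub>J \<Phi> g) \<and>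
        (\<forall>f\<in>C. norm (\<Phi> f) = (SUP x\<in>jspectrum A. \<bar>f x\<bar>)) \<and>
        \<Phi> ` C = closed_jsubalgebra hull {A, \<one>\<^sub>J})"

text \<open>
  By density of the polynomials, all \<open>\<Phi>\<close> as above agree on functions continuous on the spectrum,
  so the choice is immaterial for those; on other functions the value is unspecified.
\<close>

definition jcfc :: "(real \<Rightarrow> real) \<Rightarrow> 'a::unital_jb_algebra \<Rightarrow> 'a" where
  "jcfc f A = (SOME \<Phi>. is_functional_calculus A \<Phi>) f"

text \<open>
  Meant for positive invertible \<open>A\<close>: there the spectrum lies in \<open>(0,\<infinity>)\<close>, where
  \<open>x powr p\<close> is the usual continuous power function, for \<open>p \<le> 0\<close> as well.
\<close>

definition jpowr :: "'a::unital_jb_algebra \<Rightarrow> real \<Rightarrow> 'a" where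
  "jpowr A p = jcfc (\<lambda>x. x powr p) A"

definition harmonic_mean :: "real \<Rightarrow> 'a::unital_jb_algebra \<Rightarrow> 'a \<Rightarrow> 'a" where
  "harmonic_mean t A B = jinverse ((1 - t) *\<^sub>R jinverse A + t *\<^sub>R jinverse B)"

definition geometric_mean :: "real \<Rightarrow> 'a::unital_jb_algebra \<Rightarrow> 'a \<Rightarrow> 'a" where
  "geometric_mean t A B =
     jtriple (jpowr A (1/2)) (jpowr (jtriple (jpowr A (- 1/2)) B) t)"

definition arithmetic_mean :: "real \<Rightarrow> 'a::unital_jb_algebra \<Rightarrow> 'a \<Rightarrow> 'a" where
  "arithmetic_mean t A B = (1 - t) *\<^sub>R A + t *\<^sub>R B"

end

theory Submission
  imports Defs "HOL-Computational_Algebra.Fundamental_Theorem_Algebra"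
begin

text \<open>
  Put \<open>C = {A\<^sup>-\<^sup>1\<^sup>/\<^sup>2 B A\<^sup>-\<^sup>1\<^sup>/\<^sup>2}\<close>. The map \<open>{A\<^sup>1\<^sup>/\<^sup>2 \<cdot> A\<^sup>1\<^sup>/\<^sup>2}\<close> sends the scalar means of \<open>1\<close> and
  \<open>C\<close> to those of \<open>A\<close> and \<open>B\<close> and preserves positivity, so everything reduces to
  \<open>1 / (1 - t + t / s) \<le> s\<^sup>t \<le> 1 - t + t s\<close> on the spectrum of \<open>C\<close>.
  Compatibility with inverses comes from the fundamental formula
  \<open>U\<^bsub>{aba}\<^esub> = U\<^sub>a U\<^sub>b U\<^sub>a\<close>, where \<open>U\<^sub>a x = {axa}\<close>, which is derived from the five-linear
  identity of Jordan triple systems. For the functional calculus, the norm of \<open>x = p(a)\<close> is shown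
  to be the maximum of \<open>\<bar>p\<bar>\<close> on the spectrum: \<open>(norm x)\<^sup>2 - x\<^sup>2\<close> is not invertible, while a
  polynomial without zeros on the spectrum has an invertible value at \<open>a\<close>, its irreducible quadratic
  factors giving elements \<open>b\<^sup>2 + \<mu>\<close> with \<open>\<mu> > 0\<close>.
\<close>


section \<open>Triple products in Jordan algebras\<close>

lemma jprod_add_right: "a \<circ>\<^sub>J (b + c) = a \<circ>\<^sub>J b + a \<circ>\<^sub>J (c::'a::jordan_algebra)"
  by (metis jprod_add_left jprod_commute)

lemma jprod_scaleR_right: "a \<circ>\<^sub>J (r *\<^sub>R b) = r *\<^sub>R (a \<circ>\<^sub>J (b::'a::jordan_algebra))"
  by (metis jprod_scaleR_left jprod_commute)

lemma jprod_zero [simp]: "0 \<circ>\<^sub>J a = 0" "a \<circ>\<^sub>J 0 = (0::'a::jordan_algebra)"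
  using jprod_scaleR_left[of 0 a a] jprod_scaleR_right[of a 0 a] by auto

lemma jprod_minus_left: "(- a) \<circ>\<^sub>J b = - (a \<circ>\<^sub>J (b::'a::jordan_algebra))"
  using jprod_scaleR_left[of "-1" a b] by simp

lemma jprod_minus_right: "a \<circ>\<^sub>J (- b) = - (a \<circ>\<^sub>J (b::'a::jordan_algebra))"
  using jprod_scaleR_right[of a "-1" b] by simp

lemma jprod_diff_left: "(a - b) \<circ>\<^sub>J c = a \<circ>\<^sub>J c - b \<circ>\<^sub>J (c::'a::jordan_algebra)"
  using jprod_add_left[of a "- b" c] by (simp add: jprod_minus_left)

lemma jprod_diff_right: "a \<circ>\<^sub>J (b - c) = a \<circ>\<^sub>J b - a \<circ>\<^sub>J (c::'a::jordan_algebra)"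
  using jprod_add_right[of a b "- c"] by (simp add: jprod_minus_right)

lemmas jprod_linear =
  jprod_add_left jprod_add_right jprod_diff_left jprod_diff_right
  jprod_minus_left jprod_minus_right jprod_scaleR_left jprod_scaleR_right

lemma scaleR_3: "3 *\<^sub>R (x::'a::real_vector) = x + x + x"
  using scaleR_left_distrib[of 1 2 x] scaleR_2[of x] by simp

text \<open>Polarization of \<open>jordan_identity\<close>, which is cubic in its repeated
  variable.\<close>

lemma jordan_linearized:
  fixes a b c d :: "'a::jordan_algebra"
  shows "((a \<circ>\<^sub>J c) \<circ>\<^sub>J b) \<circ>\<^sub>J d + ((c \<circ>\<^sub>J d) \<circ>\<^sub>J b) \<circ>\<^sub>J a + ((d \<circ>\<^sub>J a) \<circ>\<^sub>J b) \<circ>\<^sub>J c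
       = (a \<circ>\<^sub>J c) \<circ>\<^sub>J (b \<circ>\<^sub>J d) + (c \<circ>\<^sub>J d) \<circ>\<^sub>J (b \<circ>\<^sub>J a) + (d \<circ>\<^sub>J a) \<circ>\<^sub>J (b \<circ>\<^sub>J c)"
    (is "?l = ?r")
proof -
  define f where "f x = ((x \<circ>\<^sub>J x) \<circ>\<^sub>J b) \<circ>\<^sub>J x - (x \<circ>\<^sub>J x) \<circ>\<^sub>J (b \<circ>\<^sub>J x)" for x
  have f0: "f x = 0" for x
    by (simp add: f_def jordan_identity)
  \<comment> \<open>Inclusion-exclusion isolates the part linear in each of \<open>a\<close>,
    \<open>c\<close> and \<open>d\<close>; its six orderings agree in pairs by commutativity, hence
    the factor 2.\<close>
  have "f (a + c + d) - f (a + c) - f (a + d) - f (c + d) + f a + f c + f d = 2 *\<^sub>R (?l - ?r)"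
    by (simp add: f_def jprod_linear jprod_commute scaleR_2 algebra_simps)
  then show ?thesis
    by (simp add: f0)
qed

text \<open>The two instances of the linearized identity arise from each other by swapping
  \<open>a\<close> and \<open>b\<close> and have equal right-hand sides. Equating their left-hand
  sides shows that the commutator of two multiplications is a derivation.\<close>

lemma jordan_derivation:
  fixes a b c x :: "'a::jordan_algebra"
  shows "a \<circ>\<^sub>J (b \<circ>\<^sub>J (c \<circ>\<^sub>J x)) - b \<circ>\<^sub>J (a \<circ>\<^sub>J (c \<circ>\<^sub>J x))
       = (a \<circ>\<^sub>J (b \<circ>\<^sub>J c) - b \<circ>\<^sub>J (a \<circ>\<^sub>J c)) \<circ>\<^sub>J x + c \<circ>\<^sub>J (a \<circ>\<^sub>J (b \<circ>\<^sub>J x) - b \<circ>\<^sub>J (a \<circ>\<^sub>J x))"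
  using jordan_linearized[of a c b x] jordan_linearized[of b c a x]
  by (simp add: jprod_linear jprod_commute algebra_simps)

section \<open>The polarized triple product and the fundamental formula\<close>

definition jtri :: "'a::jordan_algebra \<Rightarrow> 'a \<Rightarrow> 'a \<Rightarrow> 'a" where
  "jtri a b c = (a \<circ>\<^sub>J b) \<circ>\<^sub>J c + (c \<circ>\<^sub>J b) \<circ>\<^sub>J a - (a \<circ>\<^sub>J c) \<circ>\<^sub>J b"

lemma jtri_commute: "jtri a b c = jtri c b a"
  by (simp add: jtri_def jprod_commute)

lemma jtriple_jtri: "jtriple a b = jtri a b a"
  by (simp add: jtriple_def jtri_def jprod_commute scaleR_2)

lemma jtri_linear:
  "jtri (a + a') b c = jtri a b c + jtri a' b c"
  "jtri a (b + b') c = jtri a b c + jtri a b' c"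
  "jtri a b (c + c') = jtri a b c + jtri a b c'"
  "jtri (a - a') b c = jtri a b c - jtri a' b c"
  "jtri a (b - b') c = jtri a b c - jtri a b' c"
  "jtri a b (c - c') = jtri a b c - jtri a b c'"
  "jtri (r *\<^sub>R a) b c = r *\<^sub>R jtri a b c"
  "jtri a (r *\<^sub>R b) c = r *\<^sub>R jtri a b c"
  "jtri a b (r *\<^sub>R c) = r *\<^sub>R jtri a b c"
  by (simp_all add: jtri_def jprod_linear algebra_simps)

text \<open>The defect is a signed sum of three instances of \<open>jordan_linearized\<close>. The
  rule handles the multiplication part of \<open>jtri a b\<close> in the five-linear identity; the
  derivation part comes from \<open>jordan_derivation\<close>.\<close>

lemma jprod_jtri:
  "u \<circ>\<^sub>J jtri c d e = jtri (u \<circ>\<^sub>J c) d e - jtri c (u \<circ>\<^sub>J d) e + jtri c d (u \<circ>\<^sub>J e)"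
proof -
  define F where "F a b c d =
      ((a \<circ>\<^sub>J c) \<circ>\<^sub>J b) \<circ>\<^sub>J d + ((c \<circ>\<^sub>J d) \<circ>\<^sub>J b) \<circ>\<^sub>J a + ((d \<circ>\<^sub>J a) \<circ>\<^sub>J b) \<circ>\<^sub>J c
      - ((a \<circ>\<^sub>J c) \<circ>\<^sub>J (b \<circ>\<^sub>J d) + (c \<circ>\<^sub>J d) \<circ>\<^sub>J (b \<circ>\<^sub>J a) + (d \<circ>\<^sub>J a) \<circ>\<^sub>J (b \<circ>\<^sub>J c))"
    for a b c d :: 'a
  have F0: "F a b c d = 0" for a b c d
    unfolding F_def using jordan_linearized[of a c b d] by simp
  have "u \<circ>\<^sub>J jtri c d e - (jtri (u \<circ>\<^sub>J c) d e - jtri c (u \<circ>\<^sub>J d) e + jtri c d (u \<circ>\<^sub>J e))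
      = F c e d u + F e c d u - F c d e u"
    by (simp add: F_def jtri_def jprod_linear jprod_commute algebra_simps)
  then show ?thesis
    by (simp add: F0)
qed

text \<open>The operator \<open>jtri a b\<close> is multiplication by \<open>a \<circ>\<^sub>J b\<close> plus the derivation
  \<open>[L\<^sub>a, L\<^sub>b]\<close>; swapping \<open>a\<close> and \<open>b\<close> changes the sign of the derivation.\<close>

lemma jtri_jtri:
  "jtri a b (jtri c d e) = jtri (jtri a b c) d e - jtri c (jtri b a d) e + jtri c d (jtri a b e)"
proof -
  define D where "D x = a \<circ>\<^sub>J (b \<circ>\<^sub>J x) - b \<circ>\<^sub>J (a \<circ>\<^sub>J x)" for x
  have D_prod: "D (x \<circ>\<^sub>J y) = D x \<circ>\<^sub>J y + x \<circ>\<^sub>J D y" for x y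
    unfolding D_def by (rule jordan_derivation)
  have D_add: "D (x + y) = D x + D y" "D (x - y) = D x - D y" for x y
    by (simp_all add: D_def jprod_linear)
  have D_jtri: "D (jtri x y z) = jtri (D x) y z + jtri x (D y) z + jtri x y (D z)" for x y z
    by (simp add: jtri_def D_prod D_add jprod_linear)
  have ab: "jtri a b x = (a \<circ>\<^sub>J b) \<circ>\<^sub>J x + D x" for x
    by (simp add: jtri_def D_def jprod_commute)
  have ba: "jtri b a x = (a \<circ>\<^sub>J b) \<circ>\<^sub>J x - D x" for x
    by (simp add: jtri_def D_def jprod_commute)
  show ?thesis
    by (simp add: ab ba D_jtri jprod_jtri jtri_linear)
qed

text \<open>With Z the common right-hand side, the five-linear identity gives X = 2 Y - Z, and also
  Y = 2 X - Z after exchanging \<open>b\<close> and \<open>d\<close>, which leaves Z unchanged.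
  Subtracting, 3 (X - Y) = 0, so X = Y = Z.\<close>

lemma jtri_shift:
  shows "jtri a b (jtri a d a) = jtri a (jtri b a d) a"
    and "jtri (jtri a d a) b a = jtri a (jtri b a d) a"
proof -
  let ?X = "jtri a b (jtri a d a)" and ?Y = "jtri a d (jtri a b a)"
  have X: "?X = 2 *\<^sub>R ?Y - jtri a (jtri b a d) a"
    using jtri_jtri[of a b a d a] jtri_commute[of a d "jtri a b a"] by (simp add: scaleR_2)
  have Y: "?Y = 2 *\<^sub>R ?X - jtri a (jtri b a d) a"
    using jtri_jtri[of a d a b a] jtri_commute[of a b "jtri a d a"] jtri_commute[of b a d]
    by (simp add: scaleR_2)
  have "3 *\<^sub>R (x - y) = (2 *\<^sub>R x - y) - (2 *\<^sub>R y - x)" for x y :: 'a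
    by (simp add: scaleR_3 scaleR_2 algebra_simps)
  moreover have "2 *\<^sub>R ?X - ?Y = 2 *\<^sub>R ?Y - ?X"
    using X Y by (metis add_diff_cancel_right' diff_add_cancel add.commute)
  ultimately have "3 *\<^sub>R (?X - ?Y) = 0"
    by simp
  then have "?X = ?Y"
    by simp
  then show "?X = jtri a (jtri b a d) a"
    using X by (simp add: scaleR_2)
  then show "jtri (jtri a d a) b a = jtri a (jtri b a d) a"
    using jtri_commute[of a b "jtri a d a"] by simp
qed

text \<open>The five-linear identity and the shift rules bring every term of {qcq}, with q = {aba},
  to the form {a . a}. What then stands in the middle is {b {aca} b}, by the five-linear identity
  once more.\<close>

theorem jtriple_fundamental:
  "jtriple (jtriple a b) c = jtriple a (jtriple b (jtriple a c))"
proof -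
  let ?q = "jtri a b a"
  have q: "jtri ?q c a = jtri a (jtri b a c) a"
    using jtri_shift(2)[of a b c] jtri_commute[of b c]
    by (metis jtri_commute jtri_shift)
  have "jtri ?q c ?q = 2 *\<^sub>R jtri a b (jtri ?q c a) - jtri a (jtri c ?q b) a"
    using jtri_jtri[of ?q c a b a] jtri_commute[of a b "jtri ?q c a"] by (simp add: scaleR_2)
  also have "jtri a b (jtri ?q c a) = jtri a (jtri b a (jtri b a c)) a"
    by (simp add: q jtri_shift jtri_commute[of c a b])
  also have "2 *\<^sub>R jtri a (jtri b a (jtri b a c)) a - jtri a (jtri c ?q b) a
      = jtri a (2 *\<^sub>R jtri b a (jtri b a c) - jtri c ?q b) a"
    by (simp add: jtri_linear)
  also have "jtri c ?q b = jtri (jtri b a b) a c"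
    using jtri_jtri[of b a b a c] by (simp add: jtri_commute)
  also have "2 *\<^sub>R jtri b a (jtri b a c) - jtri (jtri b a b) a c = jtri b (jtri a c a) b"
    using jtri_jtri[of c a b a b]
    by (simp add: scaleR_2 jtri_commute)
  finally show ?thesis
    by (simp add: jtriple_jtri)
qed


section \<open>Inverses in Jordan algebras\<close>

lemma jprod_jone_right [simp]: "a \<circ>\<^sub>J \<one>\<^sub>J = (a::'a::unital_jb_algebra)"
  by (metis jprod_commute jprod_jone_left)

declare jprod_jone_left [simp]

lemma jtriple_linear:
  "jtriple a (b + c) = jtriple a b + jtriple a c"
  "jtriple a (b - c) = jtriple a b - jtriple a c"
  "jtriple a (r *\<^sub>R b) = r *\<^sub>R jtriple a b"
  by (simp_all add: jtriple_jtri jtri_linear)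

lemma jtriple_jone [simp]:
  "jtriple \<one>\<^sub>J a = a" "jtriple a \<one>\<^sub>J = a \<circ>\<^sub>J (a::'a::unital_jb_algebra)"
  by (simp_all add: jtriple_jtri jtri_def jprod_commute)

lemma jtriple_square: "jtriple (a \<circ>\<^sub>J a) b = jtriple a (jtriple a (b::'a::unital_jb_algebra))"
  using jtriple_fundamental[of a "\<one>\<^sub>J" b] by simp

context
  fixes a b :: "'a::unital_jb_algebra"
  assumes ab: "is_jinverse a b"
begin

lemma is_jinverse_prod: "a \<circ>\<^sub>J b = \<one>\<^sub>J" "(a \<circ>\<^sub>J a) \<circ>\<^sub>J b = a"
  using ab by (auto simp: is_jinverse_def)

lemma is_jinverse_jtriple_self: "jtriple a b = a"
  by (simp add: jtriple_def is_jinverse_prod scaleR_2)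

lemma is_jinverse_jtriple_square: "jtriple a (b \<circ>\<^sub>J b) = \<one>\<^sub>J"
proof -
  \<comment> \<open>If x and y multiply to the unit, the linearized identity loses two equal terms
    on each side and says that multiplication by the square of x commutes with multiplication by
    y.\<close>
  have comm: "(x \<circ>\<^sub>J x) \<circ>\<^sub>J (y \<circ>\<^sub>J z) = y \<circ>\<^sub>J ((x \<circ>\<^sub>J x) \<circ>\<^sub>J z)" if "x \<circ>\<^sub>J y = \<one>\<^sub>J" for x y z :: 'a
    using jordan_linearized[of x x z y] that
    by (simp add: jprod_commute algebra_simps)
  have "(a \<circ>\<^sub>J a) \<circ>\<^sub>J (b \<circ>\<^sub>J b) = \<one>\<^sub>J"
    using comm[of a b b] is_jinverse_prod by (simp add: jprod_commute)
  moreover have "(b \<circ>\<^sub>J b) \<circ>\<^sub>J (a \<circ>\<^sub>J a) = a \<circ>\<^sub>J ((b \<circ>\<^sub>J b) \<circ>\<^sub>J a)"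
    using is_jinverse_prod by (intro comm) (simp add: jprod_commute)
  ultimately show ?thesis
    by (simp add: jtriple_def jprod_commute scaleR_2)
qed

text \<open>The fundamental formula gives U_a U_b U_b U_a = 1 from U_a (b^2) = 1, and U_a U_b U_a =
  U_a from U_a b = a. The first makes U_a injective, so the second yields U_b U_a = 1.\<close>

lemma is_jinverse_jtriple_cancel: "jtriple b (jtriple a x) = x" "jtriple a (jtriple b x) = x"
proof -
  have 1: "jtriple a (jtriple b (jtriple b (jtriple a y))) = y" for y
    using jtriple_fundamental[of a "b \<circ>\<^sub>J b" y] is_jinverse_jtriple_square by (simp add: jtriple_square)
  have 2: "jtriple a (jtriple b (jtriple a y)) = jtriple a y" for y
    using jtriple_fundamental[of a b y] is_jinverse_jtriple_self by simp
  have 3: "jtriple b (jtriple a y) = y" for y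
    using 1 2 by metis
  show "jtriple b (jtriple a x) = x"
    by (rule 3)
  show "jtriple a (jtriple b x) = x"
    using 1[of x] by (simp add: 3)
qed

lemma is_jinverse_sym: "is_jinverse b a"
proof -
  have "jtriple b a = b"
    using is_jinverse_jtriple_cancel(1)[of b] by (simp add: is_jinverse_jtriple_self)
  then have "(b \<circ>\<^sub>J b) \<circ>\<^sub>J a = b"
    using is_jinverse_prod(1) by (simp add: jtriple_def jprod_commute scaleR_2 algebra_simps)
  then show ?thesis
    using is_jinverse_prod(1) by (simp add: is_jinverse_def jprod_commute)
qed

lemma is_jinverse_unique: "is_jinverse a c \<Longrightarrow> c = b"
  using is_jinverse_jtriple_cancel(1)[of b] is_jinverse_jtriple_cancel(1)[of c]
  by (simp add: is_jinverse_def jtriple_def is_jinverse_prod)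

lemma jinverse_eq: "jinverse a = b"
  unfolding jinverse_def using ab is_jinverse_unique by blast

end

lemma is_jinverse_jinverse: "jinvertible a \<Longrightarrow> is_jinverse a (jinverse a)"
  using jinverse_eq by (auto simp: jinvertible_def)

text \<open>U_a commutes with multiplication by \<open>a\<close> and by its square, so both defining
  equations of an inverse can be checked after applying U_a, which \<open>V\<close> then
  cancels.\<close>

lemma is_jinverseI:
  fixes a :: "'a::unital_jb_algebra"
  assumes V: "\<And>x. V (jtriple a x) = x" "\<And>x. jtriple a (V x) = x"
  shows "is_jinverse a (V a)"
proof -
  have jordan: "a \<circ>\<^sub>J ((a \<circ>\<^sub>J a) \<circ>\<^sub>J x) = (a \<circ>\<^sub>J a) \<circ>\<^sub>J (a \<circ>\<^sub>J x)"
      "a \<circ>\<^sub>J (x \<circ>\<^sub>J (a \<circ>\<^sub>J a)) = (a \<circ>\<^sub>J a) \<circ>\<^sub>J (a \<circ>\<^sub>J x)" for x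
    using jordan_identity[of a x] by (simp_all add: jprod_commute)
  have "jtriple a (a \<circ>\<^sub>J V a) = a \<circ>\<^sub>J jtriple a (V a)"
    by (simp add: jtriple_def jprod_linear jordan jprod_commute)
  also have "\<dots> = jtriple a \<one>\<^sub>J"
    by (simp add: V)
  finally have 1: "a \<circ>\<^sub>J V a = \<one>\<^sub>J"
    by (metis V(1))
  have "jtriple a ((a \<circ>\<^sub>J a) \<circ>\<^sub>J V a) = (a \<circ>\<^sub>J a) \<circ>\<^sub>J jtriple a (V a)"
    by (simp add: jtriple_def jprod_linear jordan jprod_commute)
  also have "\<dots> = jtriple a a"
    by (simp only: V) (simp add: jtriple_def scaleR_2 jprod_commute)
  finally have 2: "(a \<circ>\<^sub>J a) \<circ>\<^sub>J V a = a"
    by (metis V(1))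
  from 1 2 show ?thesis
    by (simp add: is_jinverse_def)
qed

text \<open>By the fundamental formula the U operator of {aba} is U_a U_b U_a, with inverse U_a'
  U_b' U_a'. The latter sends {aba} to {a' b' a'}.\<close>

lemma is_jinverse_jtriple:
  assumes a: "is_jinverse a a'" and b: "is_jinverse b b'"
  shows "is_jinverse (jtriple a b) (jtriple a' b')"
proof -
  have "is_jinverse (jtriple a b) (jtriple a' (jtriple b' (jtriple a' (jtriple a b))))"
    by (rule is_jinverseI)
       (simp_all add: jtriple_fundamental is_jinverse_jtriple_cancel[OF a] is_jinverse_jtriple_cancel[OF b])
  then show ?thesis
    by (simp add: is_jinverse_jtriple_cancel[OF a] is_jinverse_jtriple_self[OF is_jinverse_sym[OF b]])
qed


section \<open>Associative subalgebras\<close>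

interpretation jprod: bounded_bilinear "(\<circ>\<^sub>J) :: 'a::jb_algebra \<Rightarrow> 'a \<Rightarrow> 'a"
  by unfold_locales (auto simp: jprod_linear intro!: exI[of _ 1] norm_jprod_le)

lemma norm_jone_le: "norm (\<one>\<^sub>J::'a::unital_jb_algebra) \<le> 1"
  using norm_jsquare[of "\<one>\<^sub>J::'a"] by (auto simp: power2_eq_square)

definition opcomm :: "'a::jordan_algebra \<Rightarrow> 'a \<Rightarrow> bool" where
  "opcomm x y \<longleftrightarrow> (\<forall>z. x \<circ>\<^sub>J (y \<circ>\<^sub>J z) = y \<circ>\<^sub>J (x \<circ>\<^sub>J z))"

lemma opcommD: "opcomm x y \<Longrightarrow> x \<circ>\<^sub>J (y \<circ>\<^sub>J z) = y \<circ>\<^sub>J (x \<circ>\<^sub>J z)"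
  by (simp add: opcomm_def)

lemma opcomm_sym: "opcomm x y \<Longrightarrow> opcomm y x"
  by (simp add: opcomm_def)

text \<open>Commutation is demanded as operators on the whole algebra, not only on \<open>S\<close>.
  It makes \<open>S\<close> associative and later shows that inverses taken in the algebra lie in
  \<open>S\<close>.\<close>

definition opcomm_subalgebra :: "'a::unital_jb_algebra set \<Rightarrow> bool" where
  "opcomm_subalgebra S \<longleftrightarrow> closed_jsubalgebra S \<and> \<one>\<^sub>J \<in> S \<and> (\<forall>x\<in>S. \<forall>y\<in>S. opcomm x y)"

context
  fixes S :: "'a::unital_jb_algebra set"
  assumes S: "opcomm_subalgebra S"
begin

lemma subalg_closed: "closed S"
  using S by (simp add: opcomm_subalgebra_def closed_jsubalgebra_def)

lemma subalg_intros [intro, simp]: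
  "\<one>\<^sub>J \<in> S" "0 \<in> S"
  "x \<in> S \<Longrightarrow> y \<in> S \<Longrightarrow> x + y \<in> S"
  "x \<in> S \<Longrightarrow> y \<in> S \<Longrightarrow> x - y \<in> S"
  "x \<in> S \<Longrightarrow> y \<in> S \<Longrightarrow> x \<circ>\<^sub>J y \<in> S"
  "x \<in> S \<Longrightarrow> r *\<^sub>R x \<in> S"
  using S by (auto simp: opcomm_subalgebra_def closed_jsubalgebra_def subspace_0 subspace_add
      subspace_diff subspace_scale)

lemma subalg_left_commute: "x \<in> S \<Longrightarrow> y \<in> S \<Longrightarrow> x \<circ>\<^sub>J (y \<circ>\<^sub>J z) = y \<circ>\<^sub>J (x \<circ>\<^sub>J z)"
  using S by (simp add: opcomm_subalgebra_def opcommD)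

lemma subalg_assoc: "x \<in> S \<Longrightarrow> z \<in> S \<Longrightarrow> (x \<circ>\<^sub>J y) \<circ>\<^sub>J z = x \<circ>\<^sub>J (y \<circ>\<^sub>J z)"
  using subalg_left_commute[of z x y] by (simp add: jprod_commute)

lemma subalg_square_prod:
  "x \<in> S \<Longrightarrow> y \<in> S \<Longrightarrow> (x \<circ>\<^sub>J y) \<circ>\<^sub>J (x \<circ>\<^sub>J y) = (x \<circ>\<^sub>J x) \<circ>\<^sub>J (y \<circ>\<^sub>J y)"
  by (simp add: subalg_assoc subalg_left_commute)

lemma subalg_is_jinverse: "x \<in> S \<Longrightarrow> y \<in> S \<Longrightarrow> x \<circ>\<^sub>J y = \<one>\<^sub>J \<Longrightarrow> is_jinverse x y"
  by (simp add: is_jinverse_def subalg_assoc)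

section \<open>Inverses, square roots and norm bounds inside a subalgebra\<close>

lemma subalg_neumann:
  assumes x: "x \<in> S" "norm x < 1"
  shows "\<exists>y\<in>S. (\<one>\<^sub>J - x) \<circ>\<^sub>J y = \<one>\<^sub>J"
proof -
  \<comment> \<open>A fixed point of y \<mapsto> 1 + x y solves (1 - x) y = 1, and Banach's theorem
    on the complete set \<open>S\<close> keeps it in \<open>S\<close>.\<close>
  have "\<exists>!y\<in>S. \<one>\<^sub>J + x \<circ>\<^sub>J y = y"
  proof (rule Banach_fix)
    show "complete S"
      using subalg_closed by (simp add: complete_eq_closed)
    show "S \<noteq> {}"
      using subalg_intros(1) by blast
    show "dist (\<one>\<^sub>J + x \<circ>\<^sub>J y) (\<one>\<^sub>J + x \<circ>\<^sub>J z) \<le> norm x * dist y z" for y z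
      by (simp add: dist_norm norm_jprod_le flip: jprod_diff_right)
  qed (use x in auto)
  then obtain y where "y \<in> S" "\<one>\<^sub>J + x \<circ>\<^sub>J y = y"
    by blast
  then show ?thesis
    by (intro bexI[of _ y]) (simp_all add: jprod_linear algebra_simps)
qed

text \<open>The square root is \<open>1 - y\<close>, where \<open>y\<close> is the fixed point of \<open>y \<mapsto> (x + y\<^sup>2) / 2\<close>
  in the ball of radius \<open>1 - sqrt (1 - norm x)\<close>.\<close>

lemma subalg_sqrt:
  assumes x: "x \<in> S" "norm x < 1"
  shows "\<exists>s\<in>S. s \<circ>\<^sub>J s = \<one>\<^sub>J - x"
proof -
  \<comment> \<open>The smaller root of norm x + r^2 = 2 r. This keeps the ball invariant, and
    \<open>r\<close> itself serves as the contraction constant.\<close>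
  define r where "r = 1 - sqrt (1 - norm x)"
  have r: "0 \<le> r" "r < 1" "norm x + r\<^sup>2 = 2 * r"
    using x by (auto simp: r_def power2_eq_square algebra_simps)
  define f where "f y = (1/2) *\<^sub>R (x + y \<circ>\<^sub>J y)" for y
  have "\<exists>!y\<in>S \<inter> cball 0 r. f y = y"
  proof (rule Banach_fix)
    show "complete (S \<inter> cball 0 r)"
      using subalg_closed by (simp add: complete_eq_closed closed_Int)
    show "S \<inter> cball 0 r \<noteq> {}"
      using subalg_intros(2) r by (metis IntI centre_in_cball empty_iff)
    show "0 \<le> r" "r < 1"
      by fact+
    show "f ` (S \<inter> cball 0 r) \<subseteq> S \<inter> cball 0 r"
    proof safe
      fix y assume y: "y \<in> S" "y \<in> cball 0 r"
      show "f y \<in> S"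
        using x y by (simp add: f_def)
      have "norm (x + y \<circ>\<^sub>J y) \<le> norm x + norm (y \<circ>\<^sub>J y)"
        by (rule norm_triangle_ineq)
      also have "\<dots> \<le> norm x + r\<^sup>2"
        using y by (simp add: norm_jsquare power_mono)
      finally show "f y \<in> cball 0 r"
        using r by (simp add: f_def)
    qed
    show "dist (f y) (f z) \<le> r * dist y z" if yz: "y \<in> S \<inter> cball 0 r" "z \<in> S \<inter> cball 0 r" for y z
    proof -
      have "f y - f z = (1/2) *\<^sub>R ((y + z) \<circ>\<^sub>J (y - z))"
        by (simp add: f_def jprod_linear jprod_commute algebra_simps)
      moreover have "norm ((y + z) \<circ>\<^sub>J (y - z)) \<le> (2 * r) * norm (y - z)"
      proof -
        have "norm ((y + z) \<circ>\<^sub>J (y - z)) \<le> norm (y + z) * norm (y - z)"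
          by (rule norm_jprod_le)
        also have "\<dots> \<le> (2 * r) * norm (y - z)"
          using yz norm_triangle_ineq[of y z] by (intro mult_right_mono) auto
        finally show ?thesis .
      qed
      ultimately show "dist (f y) (f z) \<le> r * dist y z"
        by (simp add: dist_norm)
    qed
  qed
  then obtain y where y: "y \<in> S" "f y = y"
    by blast
  then have "x + y \<circ>\<^sub>J y = 2 *\<^sub>R y"
    unfolding f_def by (metis scaleR_half_double scaleR_2 scaleR_right_distrib)
  then have "(\<one>\<^sub>J - y) \<circ>\<^sub>J (\<one>\<^sub>J - y) = \<one>\<^sub>J - x"
    by (simp add: jprod_linear algebra_simps scaleR_2)
  then show ?thesis
    using y by blast
qed

text \<open>For u = 1 - b^2, the remainder 1 - u^2 = 2 b^2 (1 - b^2 / 2) is the square of v = sqrt 2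
  b s, where s is a square root of 1 - b^2 / 2. The norm axioms bound (norm u)^2 by the norm of u^2
  + v^2 = 1.\<close>

lemma subalg_norm_one_minus_square:
  assumes b: "b \<in> S" "norm b \<le> 1"
  shows "norm (\<one>\<^sub>J - b \<circ>\<^sub>J b) \<le> 1"
proof -
  have "norm ((1/2) *\<^sub>R (b \<circ>\<^sub>J b)) < 1"
    using b by (simp add: norm_jsquare power_le_one le_less_trans[of _ 1])
  then obtain s where s: "s \<in> S" "s \<circ>\<^sub>J s = \<one>\<^sub>J - (1/2) *\<^sub>R (b \<circ>\<^sub>J b)"
    using subalg_sqrt[of "(1/2) *\<^sub>R (b \<circ>\<^sub>J b)"] b by auto
  let ?u = "\<one>\<^sub>J - b \<circ>\<^sub>J b" and ?v = "sqrt 2 *\<^sub>R (b \<circ>\<^sub>J s)"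
  have "?v \<circ>\<^sub>J ?v = 2 *\<^sub>R ((b \<circ>\<^sub>J b) \<circ>\<^sub>J (s \<circ>\<^sub>J s))"
    using b s subalg_square_prod[of b s] by (simp add: jprod_linear)
  then have "?u \<circ>\<^sub>J ?u + ?v \<circ>\<^sub>J ?v = \<one>\<^sub>J"
    by (simp add: s jprod_linear algebra_simps scaleR_2)
  then have "(norm ?u)\<^sup>2 \<le> norm (\<one>\<^sub>J::'a)"
    using norm_jsquare_le[of ?u ?v] by (simp add: norm_jsquare)
  also have "\<dots> \<le> 1"
    by (rule norm_jone_le)
  finally show ?thesis
    by (simp add: power_le_one_iff abs_square_le_1)
qed

text \<open>After scaling \<open>b\<close> to norm at most 1, the element is a multiple of 1 + \<nu>
  - d, where \<open>d\<close> has norm at most 1 by the previous lemma and \<nu> > 0. The Neumann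
  argument applies.\<close>

lemma subalg_square_plus_invertible:
  assumes b: "b \<in> S" and \<mu>: "\<mu> > 0"
  shows "\<exists>e\<in>S. (b \<circ>\<^sub>J b + \<mu> *\<^sub>R \<one>\<^sub>J) \<circ>\<^sub>J e = \<one>\<^sub>J"
proof -
  define c where "c = 1 / (norm b + 1)"
  have c: "c > 0" "norm (c *\<^sub>R b) \<le> 1"
    by (auto simp: c_def divide_simps add_nonneg_pos)
  define \<nu> where "\<nu> = \<mu> * c\<^sup>2"
  have \<nu>: "\<nu> > 0"
    using \<mu> c by (simp add: \<nu>_def)
  define d where "d = \<one>\<^sub>J - (c *\<^sub>R b) \<circ>\<^sub>J (c *\<^sub>R b)"
  define x where "x = (1 / (1 + \<nu>)) *\<^sub>R d"
  have d: "d \<in> S" "norm d \<le> 1"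
    unfolding d_def using subalg_norm_one_minus_square[OF _ c(2)] b by auto
  have "norm x < 1"
    using \<nu> d by (simp add: x_def)
  then obtain y where y: "y \<in> S" "(\<one>\<^sub>J - x) \<circ>\<^sub>J y = \<one>\<^sub>J"
    using subalg_neumann[of x] d by (auto simp: x_def)
  have "(1 + \<nu>) *\<^sub>R (\<one>\<^sub>J - x) = (1 + \<nu>) *\<^sub>R \<one>\<^sub>J - d"
    using \<nu> by (simp add: x_def scaleR_right_diff_distrib)
  also have "\<dots> = c\<^sup>2 *\<^sub>R (b \<circ>\<^sub>J b + \<mu> *\<^sub>R \<one>\<^sub>J)"
    by (simp add: d_def \<nu>_def jprod_linear algebra_simps power2_eq_square)
  finally have "(1 / c\<^sup>2) *\<^sub>R ((1 + \<nu>) *\<^sub>R (\<one>\<^sub>J - x)) = (1 / c\<^sup>2) *\<^sub>R (c\<^sup>2 *\<^sub>R (b \<circ>\<^sub>J b + \<mu> *\<^sub>R \<one>\<^sub>J))"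
    by simp
  then have "b \<circ>\<^sub>J b + \<mu> *\<^sub>R \<one>\<^sub>J = ((1 + \<nu>) / c\<^sup>2) *\<^sub>R (\<one>\<^sub>J - x)"
    using c by simp
  then have "(b \<circ>\<^sub>J b + \<mu> *\<^sub>R \<one>\<^sub>J) \<circ>\<^sub>J ((c\<^sup>2 / (1 + \<nu>)) *\<^sub>R y) = \<one>\<^sub>J"
    using y c \<nu> by (simp add: jprod_scaleR_left jprod_scaleR_right)
  then show ?thesis
    using y by blast
qed

text \<open>With \<open>d = 1 - a\<^sup>2\<close> invertible, \<open>d - \<delta>\<close> is for small \<open>\<delta>\<close> up to a small error a square,
  and \<open>a\<^sup>2 + (d - \<delta>) = 1 - \<delta>\<close>, so the last norm axiom bounds \<open>norm (a\<^sup>2)\<close> by about \<open>1 - \<delta>\<close>.\<close>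

lemma subalg_norm_less_one:
  assumes a: "a \<in> S" "norm a \<le> 1" and e: "e \<in> S" "(\<one>\<^sub>J - a \<circ>\<^sub>J a) \<circ>\<^sub>J e = \<one>\<^sub>J"
  shows "norm a < 1"
proof -
  \<comment> \<open>This makes \<delta> times \<open>norm e\<close> less than 1, so that 1 -
    \<delta> e has a square root; with \<mu> = \<delta> / 4 the final bound 1 - \<delta> + 2 \<mu>
    stays below 1.\<close>
  define \<delta> where "\<delta> = 1 / (2 * (norm e + 1))"
  define \<mu> where "\<mu> = \<delta> / 4"
  have \<delta>: "0 < \<delta>" "\<delta> \<le> 1/2" "\<delta> * norm e < 1"
    by (auto simp: \<delta>_def divide_simps add_nonneg_pos)
  have \<mu>: "\<mu> > 0"
    using \<delta> by (simp add: \<mu>_def)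
  have "norm a ^ 2 \<le> 1"
    using a by (simp add: power_le_one)
  then have "norm ((1 / (1 + \<mu>)) *\<^sub>R (a \<circ>\<^sub>J a)) < 1"
    using \<mu> by (simp add: norm_jsquare)
  then obtain s where s: "s \<in> S" "s \<circ>\<^sub>J s = \<one>\<^sub>J - (1 / (1 + \<mu>)) *\<^sub>R (a \<circ>\<^sub>J a)"
    using subalg_sqrt[of "(1 / (1 + \<mu>)) *\<^sub>R (a \<circ>\<^sub>J a)"] a by auto
  have "norm (\<delta> *\<^sub>R e) < 1"
    using \<delta> by simp
  then obtain s' where s': "s' \<in> S" "s' \<circ>\<^sub>J s' = \<one>\<^sub>J - \<delta> *\<^sub>R e"
    using subalg_sqrt[of "\<delta> *\<^sub>R e"] e by auto
  \<comment> \<open>The square of \<open>h\<close> is (d + \<mu>) (1 - \<delta> e) with d = 1 - a^2.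
    The shift by \<mu> provides the strict norm bound that \<open>subalg_sqrt\<close>
    demands.\<close>
  define h where "h = sqrt (1 + \<mu>) *\<^sub>R (s \<circ>\<^sub>J s')"
  let ?d = "\<one>\<^sub>J - a \<circ>\<^sub>J a"
  have "h \<circ>\<^sub>J h = ((1 + \<mu>) *\<^sub>R (s \<circ>\<^sub>J s)) \<circ>\<^sub>J (s' \<circ>\<^sub>J s')"
    using s s' \<mu> subalg_square_prod[of s s'] by (simp add: h_def jprod_scaleR_left jprod_scaleR_right)
  also have "(1 + \<mu>) *\<^sub>R (s \<circ>\<^sub>J s) = ?d + \<mu> *\<^sub>R \<one>\<^sub>J"
    using \<mu> by (simp add: s scaleR_right_diff_distrib scaleR_left_distrib)
  also have "(?d + \<mu> *\<^sub>R \<one>\<^sub>J) \<circ>\<^sub>J (s' \<circ>\<^sub>J s') = ?d + \<mu> *\<^sub>R \<one>\<^sub>J - \<delta> *\<^sub>R (?d \<circ>\<^sub>J e) - (\<mu> * \<delta>) *\<^sub>R e"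
    by (simp add: s' jprod_linear algebra_simps)
  finally have "a \<circ>\<^sub>J a + h \<circ>\<^sub>J h = (1 - \<delta> + \<mu>) *\<^sub>R \<one>\<^sub>J - (\<mu> * \<delta>) *\<^sub>R e"
    by (simp add: e algebra_simps)
  then have "(norm a)\<^sup>2 \<le> norm ((1 - \<delta> + \<mu>) *\<^sub>R \<one>\<^sub>J - (\<mu> * \<delta>) *\<^sub>R e)"
    using norm_jsquare_le[of a h] by (simp add: norm_jsquare)
  also have "\<dots> \<le> norm ((1 - \<delta> + \<mu>) *\<^sub>R (\<one>\<^sub>J::'a)) + norm ((\<mu> * \<delta>) *\<^sub>R e)"
    by (rule norm_triangle_ineq4)
  also have "\<dots> \<le> (1 - \<delta> + \<mu>) * 1 + \<mu> * (\<delta> * norm e)"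
    using \<delta> \<mu> norm_jone_le[where ?'a = 'a]
    by (intro add_mono) (simp_all add: abs_of_nonneg mult_left_le)
  also have "\<dots> \<le> (1 - \<delta> + \<mu>) * 1 + \<mu> * 1"
    using \<delta> \<mu> by (intro add_left_mono mult_left_mono) auto
  also have "\<dots> < 1"
    using \<delta> by (simp add: \<mu>_def)
  finally show ?thesis
    by (simp add: power_less_one_iff abs_square_less_1)
qed

text \<open>After scaling \<open>a\<close> to norm 1, an inverse would push the norm strictly below
  1 by \<open>subalg_norm_less_one\<close>.\<close>

lemma subalg_norm_not_invertible:
  assumes a: "a \<in> S" "a \<noteq> 0" and e: "e \<in> S"
  shows "((norm a)\<^sup>2 *\<^sub>R \<one>\<^sub>J - a \<circ>\<^sub>J a) \<circ>\<^sub>J e \<noteq> \<one>\<^sub>J"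
proof
  assume *: "((norm a)\<^sup>2 *\<^sub>R \<one>\<^sub>J - a \<circ>\<^sub>J a) \<circ>\<^sub>J e = \<one>\<^sub>J"
  let ?a = "(1 / norm a) *\<^sub>R a"
  have "(\<one>\<^sub>J - ?a \<circ>\<^sub>J ?a) \<circ>\<^sub>J ((norm a)\<^sup>2 *\<^sub>R e) = ((norm a)\<^sup>2 *\<^sub>R \<one>\<^sub>J - a \<circ>\<^sub>J a) \<circ>\<^sub>J e"
    using a by (simp add: jprod_linear power2_eq_square scaleR_right_diff_distrib)
  then have "norm ?a < 1"
    using * a e by (intro subalg_norm_less_one[of ?a "(norm a)\<^sup>2 *\<^sub>R e"]) auto
  then show False
    using a by simp
qed

text \<open>The square of the inverse is the limit of \<open>(a\<^sup>2 + \<mu>)\<^sup>-\<^sup>1\<close> as \<open>\<mu>\<close> tends to \<open>0\<close>.\<close>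

lemma subalg_jinverse_mem:
  assumes a: "a \<in> S" and ab: "is_jinverse a b"
  shows "b \<in> S"
proof -
  have U_a: "jtriple a (x \<circ>\<^sub>J z) = x \<circ>\<^sub>J jtriple a z" if "x \<in> S" for x z
    using a that
    by (simp add: jtriple_def jprod_linear subalg_left_commute[of x a] subalg_left_commute[of x "a \<circ>\<^sub>J a"]
        jprod_commute[of "a \<circ>\<^sub>J _" a])
  \<comment> \<open>U_b inverts U_a and so inherits its commutation with multiplication by elements
    of \<open>S\<close>, although \<open>b\<close> is not yet known to lie there.\<close>
  have U_b: "jtriple b (x \<circ>\<^sub>J z) = x \<circ>\<^sub>J jtriple b z" if "x \<in> S" for x z
    using U_a[OF that, of "jtriple b z"] is_jinverse_jtriple_cancel[OF ab] by metis
  have U_b1: "jtriple b x = x \<circ>\<^sub>J (b \<circ>\<^sub>J b)" if "x \<in> S" for x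
    using U_b[OF that, of "\<one>\<^sub>J"] by simp
  define M where "M = norm (b \<circ>\<^sub>J b)"
  have M: "M \<ge> 0"
    by (simp add: M_def)
  have "\<exists>y\<in>S. dist y (b \<circ>\<^sub>J b) < \<epsilon>" if \<epsilon>: "\<epsilon> > 0" for \<epsilon>
  proof -
    \<comment> \<open>The first bound gives \<mu> M \<le> 1/2 and hence norm e \<le> 2 M; the second
      brings the error 2 \<mu> M^2 below \<epsilon>.\<close>
    define \<mu> where "\<mu> = min (1 / (2 * (M + 1))) (\<epsilon> / (2 * M * M + 1))"
    have \<mu>0: "\<mu> > 0"
      using M \<epsilon> by (auto simp: \<mu>_def add_nonneg_pos)
    have "\<mu> * (2 * (M + 1)) \<le> 1"
      using M by (subst pos_le_divide_eq[symmetric]) (simp_all add: \<mu>_def)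
    then have \<mu>1: "\<mu> * M \<le> 1/2"
      using \<mu>0 by (simp add: algebra_simps)
    have "\<mu> * (2 * M * M + 1) \<le> \<epsilon>"
      using M by (simp add: \<mu>_def min_le_iff_disj add_nonneg_pos flip: pos_le_divide_eq)
    then have \<mu>2: "\<mu> * (2 * M * M) < \<epsilon>"
      using \<mu>0 by (simp add: algebra_simps)
    obtain e where e: "e \<in> S" "(a \<circ>\<^sub>J a + \<mu> *\<^sub>R \<one>\<^sub>J) \<circ>\<^sub>J e = \<one>\<^sub>J"
      using subalg_square_plus_invertible[OF a \<mu>0] by blast
    have "jtriple a e = (a \<circ>\<^sub>J a) \<circ>\<^sub>J e"
      using U_a[OF e(1), of "\<one>\<^sub>J"] by (simp add: jprod_commute)
    then have "\<one>\<^sub>J = jtriple a e + \<mu> *\<^sub>R e"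
      using e by (simp add: jprod_linear)
    then have "b \<circ>\<^sub>J b = jtriple b (jtriple a e + \<mu> *\<^sub>R e)"
      by (metis jtriple_jone(2))
    also have "\<dots> = e + \<mu> *\<^sub>R (e \<circ>\<^sub>J (b \<circ>\<^sub>J b))"
      using e by (simp add: jtriple_linear is_jinverse_jtriple_cancel[OF ab] U_b1)
    finally have bb: "b \<circ>\<^sub>J b = e + \<mu> *\<^sub>R (e \<circ>\<^sub>J (b \<circ>\<^sub>J b))" .
    have n: "norm (\<mu> *\<^sub>R (e \<circ>\<^sub>J (b \<circ>\<^sub>J b))) \<le> \<mu> * (norm e * M)"
      using \<mu>0 by (simp add: M_def norm_jprod_le)
    have "norm e = norm (b \<circ>\<^sub>J b - \<mu> *\<^sub>R (e \<circ>\<^sub>J (b \<circ>\<^sub>J b)))"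
      by (subst (1) bb) simp
    also have "\<dots> \<le> M + \<mu> * (norm e * M)"
      using n norm_triangle_ineq4[of "b \<circ>\<^sub>J b" "\<mu> *\<^sub>R (e \<circ>\<^sub>J (b \<circ>\<^sub>J b))"] by (simp add: M_def)
    also have "\<dots> \<le> M + 1/2 * norm e"
      using mult_right_mono[OF \<mu>1, of "norm e"] by (simp add: mult_ac)
    finally have "norm e \<le> 2 * M"
      by simp
    have "dist e (b \<circ>\<^sub>J b) = norm (\<mu> *\<^sub>R (e \<circ>\<^sub>J (b \<circ>\<^sub>J b)))"
      by (subst (1) bb) (simp add: dist_norm)
    also have "\<dots> \<le> \<mu> * (norm e * M)"
      by (rule n)
    also have "\<dots> \<le> \<mu> * (2 * M * M)"
      using \<open>norm e \<le> 2 * M\<close> M \<mu>0 by (intro mult_left_mono mult_right_mono) auto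
    also have "\<dots> < \<epsilon>"
      by (rule \<mu>2)
    finally show ?thesis
      using e by blast
  qed
  then have "b \<circ>\<^sub>J b \<in> S"
    using closed_approachable[OF subalg_closed] by blast
  moreover have "b = a \<circ>\<^sub>J (b \<circ>\<^sub>J b)"
    using U_b1[OF a] is_jinverse_jtriple_self[OF is_jinverse_sym[OF ab]] by simp
  ultimately show ?thesis
    using a by (metis subalg_intros(5))
qed

text \<open>Spectral permanence: this lets the spectrum be computed inside \<open>S\<close>.\<close>

lemma subalg_jinvertible_iff: "x \<in> S \<Longrightarrow> jinvertible x \<longleftrightarrow> (\<exists>y\<in>S. x \<circ>\<^sub>J y = \<one>\<^sub>J)"
  using subalg_is_jinverse subalg_jinverse_mem is_jinverse_prod(1) unfolding jinvertible_def by blast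

end


section \<open>Polynomials in one element\<close>

definition jpoly :: "real poly \<Rightarrow> 'a::unital_jb_algebra \<Rightarrow> 'a" where
  "jpoly p a = fold_coeffs (\<lambda>c x. c *\<^sub>R \<one>\<^sub>J + a \<circ>\<^sub>J x) p 0"

lemma jpoly_0 [simp]: "jpoly 0 a = 0"
  by (simp add: jpoly_def)

lemma jpoly_pCons [simp]: "jpoly (pCons c p) a = c *\<^sub>R \<one>\<^sub>J + a \<circ>\<^sub>J jpoly p a"
  by (cases "p = 0 \<and> c = 0") (auto simp: jpoly_def)

lemma jpoly_1 [simp]: "jpoly 1 a = \<one>\<^sub>J"
  by (simp add: one_pCons)

lemma jpoly_add: "jpoly (p + q) a = jpoly p a + jpoly q a"
  by (induction p q rule: poly_induct2) (simp_all add: jprod_linear algebra_simps)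

lemma jpoly_smult: "jpoly (smult c p) a = c *\<^sub>R jpoly p a"
  by (induction p) (simp_all add: jprod_linear algebra_simps)

lemma jpoly_diff: "jpoly (p - q) a = jpoly p a - jpoly q a"
  using jpoly_add[of "p - q" q a] by simp

section \<open>Operator commutation and products of polynomials\<close>

lemma opcomm_jone: "opcomm x \<one>\<^sub>J"
  by (simp add: opcomm_def)

lemma opcomm_add: "opcomm x y \<Longrightarrow> opcomm x z \<Longrightarrow> opcomm x (y + z)"
  by (simp add: opcomm_def jprod_linear)

lemma opcomm_scaleR: "opcomm x y \<Longrightarrow> opcomm x (r *\<^sub>R y)"
  by (simp add: opcomm_def jprod_linear)

lemma opcomm_zero: "opcomm x 0"
  by (simp add: opcomm_def)

text \<open>The linearized identity expresses multiplication by a (a x) through multiplications by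
  a, a^2, x and a x, and \<open>y\<close> operator commutes with all of these.\<close>

lemma opcomm_twice:
  assumes ya: "opcomm y a" and ya2: "opcomm y (a \<circ>\<^sub>J a)" and yx: "opcomm y x" and yax: "opcomm y (a \<circ>\<^sub>J x)"
  shows "opcomm y (a \<circ>\<^sub>J (a \<circ>\<^sub>J x))"
proof -
  have eq: "(a \<circ>\<^sub>J (a \<circ>\<^sub>J x)) \<circ>\<^sub>J z = 2 *\<^sub>R ((a \<circ>\<^sub>J x) \<circ>\<^sub>J (a \<circ>\<^sub>J z)) + (a \<circ>\<^sub>J a) \<circ>\<^sub>J (x \<circ>\<^sub>J z)
      - a \<circ>\<^sub>J (a \<circ>\<^sub>J (x \<circ>\<^sub>J z)) - x \<circ>\<^sub>J (a \<circ>\<^sub>J (a \<circ>\<^sub>J z))" for z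
    using jordan_linearized[of a x a z] by (simp add: jprod_commute scaleR_2 algebra_simps)
  show ?thesis
    unfolding opcomm_def eq
    by (simp add: jprod_linear opcommD[OF ya] opcommD[OF ya2] opcommD[OF yx] opcommD[OF yax])
qed

lemma opcomm_jpoly:
  assumes "opcomm y a" "opcomm y (a \<circ>\<^sub>J a)"
  shows "opcomm y (jpoly p a)"
proof -
  \<comment> \<open>Carrying two consecutive terms matches the two-step recursion of
    \<open>opcomm_twice\<close>.\<close>
  have "opcomm y (jpoly p a) \<and> opcomm y (a \<circ>\<^sub>J jpoly p a)"
    by (induction p)
       (simp_all add: assms jprod_linear opcomm_add opcomm_scaleR opcomm_jone opcomm_zero opcomm_twice)
  then show ?thesis
    by simp
qed

text \<open>The Jordan identity is the base case, \<open>a\<close> against its square. Then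
  \<open>opcomm_jpoly\<close> applies first to \<open>a\<close> and to its square against p(a), and
  after exchanging the sides to p(a) against q(a).\<close>

lemma opcomm_jpoly_jpoly: "opcomm (jpoly p a) (jpoly q a)"
proof -
  have "opcomm a a" "opcomm (a \<circ>\<^sub>J a) (a \<circ>\<^sub>J a)"
    by (simp_all add: opcomm_def)
  moreover have "opcomm a (a \<circ>\<^sub>J a)"
    unfolding opcomm_def using jordan_identity[of a] by (metis jprod_commute)
  ultimately have "opcomm a (jpoly p a)" "opcomm (a \<circ>\<^sub>J a) (jpoly p a)"
    by (auto intro: opcomm_jpoly opcomm_sym)
  then show ?thesis
    by (auto intro: opcomm_jpoly opcomm_sym)
qed

lemma jpoly_mult: "jpoly (p * q) a = jpoly p a \<circ>\<^sub>J jpoly q a"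
proof (induction p)
  case (pCons c p)
  have "opcomm a (jpoly q a)"
    using opcomm_jpoly_jpoly[of "[:0, 1:]" a q] by simp
  then have "(a \<circ>\<^sub>J jpoly p a) \<circ>\<^sub>J jpoly q a = a \<circ>\<^sub>J (jpoly p a \<circ>\<^sub>J jpoly q a)"
    by (metis opcommD jprod_commute)
  then show ?case
    by (simp add: jpoly_add jpoly_smult pCons jprod_linear)
qed simp

section \<open>The closed subalgebra generated by one element\<close>

definition jgen :: "'a::unital_jb_algebra \<Rightarrow> 'a set" where
  "jgen a = closure (range (\<lambda>p. jpoly p a))"

lemma jpoly_in_jgen [simp]: "jpoly p a \<in> jgen a"
  unfolding jgen_def by (rule subsetD[OF closure_subset]) simp

lemma in_jgenE:
  assumes "x \<in> jgen a"
  obtains p where "(\<lambda>n. jpoly (p n) a) \<longlonglongrightarrow> x"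
proof -
  from assms obtain u where u: "\<And>n::nat. u n \<in> range (\<lambda>p. jpoly p a)" "u \<longlonglongrightarrow> x"
    unfolding jgen_def closure_sequential by blast
  then have "\<forall>n. \<exists>p. u n = jpoly p a"
    by blast
  then obtain p where "\<And>n. u n = jpoly (p n) a"
    by metis
  then have "u = (\<lambda>n. jpoly (p n) a)"
    by auto
  then show ?thesis
    using that u by blast
qed

lemma in_jgenI: "(\<lambda>n. jpoly (p n) a) \<longlonglongrightarrow> x \<Longrightarrow> x \<in> jgen a"
  unfolding jgen_def closure_sequential by (intro exI[of _ "\<lambda>n. jpoly (p n) a"]) auto

lemma closed_jsubalgebra_jgen: "closed_jsubalgebra (jgen a)"
  unfolding closed_jsubalgebra_def
proof (intro conjI ballI)
  show "subspace (jgen a)"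
  proof (rule subspaceI)
    show "0 \<in> jgen a"
      using jpoly_in_jgen[of 0] by simp
  next
    fix x y assume "x \<in> jgen a" "y \<in> jgen a"
    then obtain p q where "(\<lambda>n. jpoly (p n) a) \<longlonglongrightarrow> x" "(\<lambda>n. jpoly (q n) a) \<longlonglongrightarrow> y"
      using in_jgenE by metis
    then have "(\<lambda>n. jpoly (p n + q n) a) \<longlonglongrightarrow> x + y"
      by (simp add: jpoly_add tendsto_add)
    then show "x + y \<in> jgen a"
      by (rule in_jgenI)
  next
    fix x r assume "x \<in> jgen a"
    then obtain p where "(\<lambda>n. jpoly (p n) a) \<longlonglongrightarrow> x"
      using in_jgenE by metis
    then have "(\<lambda>n. jpoly (smult r (p n)) a) \<longlonglongrightarrow> r *\<^sub>R x"
      by (simp add: jpoly_smult tendsto_scaleR)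
    then show "r *\<^sub>R x \<in> jgen a"
      by (rule in_jgenI)
  qed
  show "closed (jgen a)"
    by (simp add: jgen_def)
  fix x y assume "x \<in> jgen a" "y \<in> jgen a"
  then obtain p q where "(\<lambda>n. jpoly (p n) a) \<longlonglongrightarrow> x" "(\<lambda>n. jpoly (q n) a) \<longlonglongrightarrow> y"
    using in_jgenE by metis
  then have "(\<lambda>n. jpoly (p n * q n) a) \<longlonglongrightarrow> x \<circ>\<^sub>J y"
    by (simp add: jpoly_mult jprod.tendsto)
  then show "x \<circ>\<^sub>J y \<in> jgen a"
    by (rule in_jgenI)
qed

lemma opcomm_subalgebra_jgen: "opcomm_subalgebra (jgen a)"
  unfolding opcomm_subalgebra_def
proof (intro conjI ballI)
  show "\<one>\<^sub>J \<in> jgen a"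
    using jpoly_in_jgen[of 1] by simp
  fix x y assume "x \<in> jgen a" "y \<in> jgen a"
  then obtain p q where p: "(\<lambda>n. jpoly (p n) a) \<longlonglongrightarrow> x" and q: "(\<lambda>n. jpoly (q n) a) \<longlonglongrightarrow> y"
    using in_jgenE by metis
  show "opcomm x y"
    unfolding opcomm_def
  proof
    fix z
    have "(\<lambda>n. jpoly (p n) a \<circ>\<^sub>J (jpoly (q n) a \<circ>\<^sub>J z)) \<longlonglongrightarrow> x \<circ>\<^sub>J (y \<circ>\<^sub>J z)"
      by (intro jprod.tendsto p q tendsto_const)
    moreover have "(\<lambda>n. jpoly (p n) a \<circ>\<^sub>J (jpoly (q n) a \<circ>\<^sub>J z)) \<longlonglongrightarrow> y \<circ>\<^sub>J (x \<circ>\<^sub>J z)"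
      by (subst opcommD[OF opcomm_jpoly_jpoly]) (intro jprod.tendsto p q tendsto_const)
    ultimately show "x \<circ>\<^sub>J (y \<circ>\<^sub>J z) = y \<circ>\<^sub>J (x \<circ>\<^sub>J z)"
      by (rule LIMSEQ_unique)
  qed
qed (rule closed_jsubalgebra_jgen)

lemma jgen_intros [simp]: "\<one>\<^sub>J \<in> jgen a" "a \<in> jgen a"
  using jpoly_in_jgen[of 1 a] jpoly_in_jgen[of "[:0, 1:]" a] by simp_all

lemma hull_eq_jgen: "closed_jsubalgebra hull {a, \<one>\<^sub>J} = jgen a"
proof (rule hull_unique)
  show "{a, \<one>\<^sub>J} \<subseteq> jgen a"
    by simp
  show "closed_jsubalgebra (jgen a)"
    by (rule closed_jsubalgebra_jgen)
  fix T assume T: "{a, \<one>\<^sub>J} \<subseteq> T" "closed_jsubalgebra T"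
  have "jpoly p a \<in> T" for p
    using T by (induction p) (auto simp: closed_jsubalgebra_def subspace_0 subspace_add subspace_scale)
  then show "jgen a \<subseteq> T"
    unfolding jgen_def using T by (intro closure_minimal) (auto simp: closed_jsubalgebra_def)
qed

lemmas jgen_algebra = subalg_intros[OF opcomm_subalgebra_jgen]
lemmas jgen_ac = subalg_assoc[OF opcomm_subalgebra_jgen] subalg_left_commute[OF opcomm_subalgebra_jgen]

lemma jgen_prod_inverse:
  assumes "x \<in> jgen a" "y \<in> jgen a" "x' \<in> jgen a" "y' \<in> jgen a"
    and "x \<circ>\<^sub>J x' = \<one>\<^sub>J" "y \<circ>\<^sub>J y' = \<one>\<^sub>J"
  shows "(x \<circ>\<^sub>J y) \<circ>\<^sub>J (x' \<circ>\<^sub>J y') = \<one>\<^sub>J"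
proof -
  have "(x \<circ>\<^sub>J y) \<circ>\<^sub>J (x' \<circ>\<^sub>J y') = (x \<circ>\<^sub>J x') \<circ>\<^sub>J (y \<circ>\<^sub>J y')"
    using assms(1-4) by (simp add: jgen_ac jgen_algebra)
  then show ?thesis
    by (simp add: assms)
qed

section \<open>Spectrum and norm of polynomials in one element\<close>

lemma not_in_jspectrumD:
  assumes "t \<notin> jspectrum a"
  shows "\<exists>y\<in>jgen a. (a - t *\<^sub>R \<one>\<^sub>J) \<circ>\<^sub>J y = \<one>\<^sub>J"
  using assms subalg_jinvertible_iff[OF opcomm_subalgebra_jgen, of "a - t *\<^sub>R \<one>\<^sub>J" a]
  by (simp add: jspectrum_def jgen_algebra)

lemma in_jspectrumD:
  assumes "t \<in> jspectrum a" "y \<in> jgen a"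
  shows "(a - t *\<^sub>R \<one>\<^sub>J) \<circ>\<^sub>J y \<noteq> \<one>\<^sub>J"
  using assms subalg_jinvertible_iff[OF opcomm_subalgebra_jgen, of "a - t *\<^sub>R \<one>\<^sub>J" a]
  by (auto simp: jspectrum_def jgen_algebra)

lemma real_poly_factor_cases:
  fixes q :: "real poly"
  assumes "degree q > 0"
  obtains (linear) r q' where "q = [:-r, 1:] * q'"
    | (quadratic) \<alpha> \<beta> q' where "\<beta> \<noteq> 0" "q = [:\<alpha>\<^sup>2 + \<beta>\<^sup>2, -2 * \<alpha>, 1:] * q'"
proof -
  define c where "c z p = poly (map_poly complex_of_real p) z" for z p
  have c0 [simp]: "c z 0 = 0" for z
    by (simp add: c_def)
  have c_pCons [simp]: "c z (pCons r p) = of_real r + z * c z p" for z r p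
    by (simp add: c_def map_poly_pCons)
  have c_add: "c z (p + p') = c z p + c z p'" for z p p'
    by (induction p p' rule: poly_induct2) (simp_all add: algebra_simps)
  have c_smult: "c z (smult r p) = of_real r * c z p" for z r p
    by (induction p) (simp_all add: algebra_simps)
  have c_mult: "c z (p * p') = c z p * c z p'" for z p p'
    by (induction p) (simp_all add: c_add c_smult algebra_simps)
  have "degree (map_poly complex_of_real q) > 0"
    using assms by (simp add: degree_map_poly)
  then obtain z where z: "c z q = 0"
    using alg_closed_imp_poly_has_root[of "map_poly complex_of_real q"] unfolding c_def by blast
  have real: "c (of_real r) p = of_real (poly p r)" for r p
    by (induction p) simp_all
  show thesis
  proof (cases "Im z = 0")
    case True
    then have "z = of_real (Re z)"
      by (simp add: complex_eq_iff)
    then have "poly q (Re z) = 0"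
      using z real[of "Re z" q] by simp
    then show ?thesis
      using linear by (auto simp: poly_eq_0_iff_dvd elim!: dvdE)
  next
    case False
    \<comment> \<open>The monic real quadratic with roots \<open>z\<close> and its conjugate. A real
      remainder of degree below 2 that vanishes at the non-real \<open>z\<close> must be 0.\<close>
    define m where "m = [:(Re z)\<^sup>2 + (Im z)\<^sup>2, -2 * Re z, 1:]"
    define s where "s = q mod m"
    have q: "q = m * (q div m) + s"
      by (simp add: s_def)
    have "c z m = 0"
      by (simp add: m_def complex_eq_iff power2_eq_square algebra_simps)
    then have cs: "c z s = 0"
      using z q by (metis c_add c_mult mult_zero_left add_0)
    have "s = 0 \<or> degree s < degree m"
      unfolding s_def by (rule degree_mod_less) (simp add: m_def)
    then have "degree s < 2"
      by (auto simp: m_def)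
    then have "s = [:coeff s 0, coeff s 1:]"
      by (intro poly_eqI) (auto simp: coeff_pCons coeff_eq_0 split: nat.splits)
    then obtain u v where s: "s = [:u, v:]"
      by blast
    from cs have "v * Im z = 0" "u + v * Re z = 0"
      by (auto simp: s complex_eq_iff mult.commute)
    with False have "s = 0"
      by (simp add: s)
    with q False show ?thesis
      using quadratic[of "Im z" "Re z" "q div m"] by (simp add: m_def)
  qed
qed

text \<open>Induction on the degree, splitting off a factor. The root of a linear factor is a root
  of \<open>q\<close>, so it lies outside the spectrum; a quadratic factor becomes (a - \<alpha>)^2
  + \<beta>^2 with \<beta> nonzero. Inverses in \<open>jgen a\<close> multiply.\<close>

lemma jpoly_invertible:
  assumes "q \<noteq> 0" "\<And>t. t \<in> jspectrum a \<Longrightarrow> poly q t \<noteq> 0"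
  shows "\<exists>y\<in>jgen a. jpoly q a \<circ>\<^sub>J y = \<one>\<^sub>J"
  using assms
proof (induction "degree q" arbitrary: q rule: less_induct)
  case less
  show ?case
  proof (cases "degree q = 0")
    case True
    then obtain c where c: "q = [:c:]"
      by (rule degree_eq_zeroE)
    then have "jpoly q a \<circ>\<^sub>J ((1 / c) *\<^sub>R \<one>\<^sub>J) = \<one>\<^sub>J"
      using less.prems by (simp add: jprod_linear)
    then show ?thesis
      using jgen_algebra(6)[OF jgen_intros(1)] by blast
  next
    case False
    have product: ?thesis
      if q: "q = m * q'" and m: "degree m > 0" and y: "y \<in> jgen a" "jpoly m a \<circ>\<^sub>J y = \<one>\<^sub>J" for m q' y
    proof -
      have "q' \<noteq> 0" "m \<noteq> 0"
        using less.prems(1) q by auto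
      then have "degree q' < degree q"
        using m by (simp add: q degree_mult_eq)
      moreover have "poly q' t \<noteq> 0" if "t \<in> jspectrum a" for t
        using less.prems(2)[OF that] q by auto
      ultimately obtain y' where "y' \<in> jgen a" "jpoly q' a \<circ>\<^sub>J y' = \<one>\<^sub>J"
        using less.hyps[of q'] \<open>q' \<noteq> 0\<close> by blast
      then show ?thesis
        using y jgen_prod_inverse[of "jpoly m a" a "jpoly q' a" y y']
        by (intro bexI[of _ "y \<circ>\<^sub>J y'"]) (auto simp: q jpoly_mult jgen_algebra)
    qed
    from False have "degree q > 0"
      by simp
    then show ?thesis
    proof (cases rule: real_poly_factor_cases)
      case (linear r q')
      then have "r \<notin> jspectrum a"
        using less.prems(2)[of r] by auto
      then obtain y where y: "y \<in> jgen a" "(a - r *\<^sub>R \<one>\<^sub>J) \<circ>\<^sub>J y = \<one>\<^sub>J"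
        using not_in_jspectrumD by blast
      have "jpoly [:- r, 1:] a = a - r *\<^sub>R \<one>\<^sub>J"
        by simp
      with y show ?thesis
        by (intro product[of "[:-r, 1:]" q' y]) (simp_all add: linear)
    next
      case (quadratic \<alpha> \<beta> q')
      let ?b = "a - \<alpha> *\<^sub>R \<one>\<^sub>J"
      obtain y where y: "y \<in> jgen a" "(?b \<circ>\<^sub>J ?b + \<beta>\<^sup>2 *\<^sub>R \<one>\<^sub>J) \<circ>\<^sub>J y = \<one>\<^sub>J"
        using subalg_square_plus_invertible[OF opcomm_subalgebra_jgen, of ?b a "\<beta>\<^sup>2"] quadratic(1)
        by (auto simp: jgen_algebra)
      have "jpoly [:\<alpha>\<^sup>2 + \<beta>\<^sup>2, -2 * \<alpha>, 1:] a = ?b \<circ>\<^sub>J ?b + \<beta>\<^sup>2 *\<^sub>R \<one>\<^sub>J"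
        by (simp add: jprod_linear power2_eq_square algebra_simps flip: scaleR_2)
      with y show ?thesis
        by (intro product[of "[:\<alpha>\<^sup>2 + \<beta>\<^sup>2, -2 * \<alpha>, 1:]" q' y]) (simp_all add: quadratic)
    qed
  qed
qed

lemma jgen_neumann:
  assumes "x \<in> jgen a" "norm x < \<bar>c\<bar>"
  shows "\<exists>y\<in>jgen a. (c *\<^sub>R \<one>\<^sub>J - x) \<circ>\<^sub>J y = \<one>\<^sub>J"
proof -
  have c: "c \<noteq> 0"
    using assms by auto
  then have "norm ((1 / c) *\<^sub>R x) < 1"
    using assms by (simp add: field_simps)
  then obtain y where y: "y \<in> jgen a" "(\<one>\<^sub>J - (1 / c) *\<^sub>R x) \<circ>\<^sub>J y = \<one>\<^sub>J"
    using subalg_neumann[OF opcomm_subalgebra_jgen] jgen_algebra(6)[OF assms(1)] by blast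
  then have "(c *\<^sub>R \<one>\<^sub>J - x) \<circ>\<^sub>J ((1 / c) *\<^sub>R y) = \<one>\<^sub>J"
    using c by (simp add: jprod_linear scaleR_right_diff_distrib)
  then show ?thesis
    using y jgen_algebra(6) by blast
qed

text \<open>Otherwise the Neumann argument inverts p(t) - p(a). As a - t divides this element, a - t
  would be invertible too, against the choice of \<open>t\<close>.\<close>

lemma abs_poly_le_norm_jpoly:
  assumes t: "t \<in> jspectrum a"
  shows "\<bar>poly p t\<bar> \<le> norm (jpoly p a)"
proof (rule ccontr)
  assume "\<not> ?thesis"
  then obtain y where y: "y \<in> jgen a" "(poly p t *\<^sub>R \<one>\<^sub>J - jpoly p a) \<circ>\<^sub>J y = \<one>\<^sub>J"
    using jgen_neumann[of "jpoly p a" a "poly p t"] by auto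
  have "poly ([:poly p t:] - p) t = 0"
    by simp
  then obtain q where q: "[:poly p t:] - p = [:- t, 1:] * q"
    unfolding poly_eq_0_iff_dvd by (elim dvdE)
  have "poly p t *\<^sub>R \<one>\<^sub>J - jpoly p a = jpoly ([:poly p t:] - p) a"
    by (simp add: jpoly_diff)
  also have "\<dots> = (a - t *\<^sub>R \<one>\<^sub>J) \<circ>\<^sub>J jpoly q a"
    unfolding q jpoly_mult by simp
  finally have "(a - t *\<^sub>R \<one>\<^sub>J) \<circ>\<^sub>J (jpoly q a \<circ>\<^sub>J y) = \<one>\<^sub>J"
    using y subalg_assoc[OF opcomm_subalgebra_jgen, of "a - t *\<^sub>R \<one>\<^sub>J" a y "jpoly q a"]
    by (simp add: jgen_algebra)
  moreover have "jpoly q a \<circ>\<^sub>J y \<in> jgen a"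
    using y by (simp add: jgen_algebra)
  ultimately show False
    using in_jspectrumD[OF t] by blast
qed

text \<open>If \<open>e\<close> inverts a - t, then a - s = (a - t) (1 - (s - t) e), and the second
  factor is invertible for \<open>s\<close> close to \<open>t\<close>.\<close>

lemma closed_jspectrum: "closed (jspectrum a)"
proof -
  have "open (- jspectrum a)"
    unfolding open_dist
  proof safe
    fix t assume "t \<notin> jspectrum a"
    then obtain e where e: "e \<in> jgen a" "(a - t *\<^sub>R \<one>\<^sub>J) \<circ>\<^sub>J e = \<one>\<^sub>J"
      using not_in_jspectrumD by blast
    have "s \<notin> jspectrum a" if s: "dist s t < 1 / (norm e + 1)" for s
    proof
      assume "s \<in> jspectrum a"
      have "\<bar>s - t\<bar> * (norm e + 1) < 1"
        using s by (simp add: dist_real_def pos_less_divide_eq add_nonneg_pos)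
      then have "norm ((s - t) *\<^sub>R e) < \<bar>1\<bar>"
        by (simp add: distrib_left)
      then obtain y where y: "y \<in> jgen a" "(1 *\<^sub>R \<one>\<^sub>J - (s - t) *\<^sub>R e) \<circ>\<^sub>J y = \<one>\<^sub>J"
        using jgen_neumann[of "(s - t) *\<^sub>R e" a 1] e by (auto simp: jgen_algebra)
      have "(a - t *\<^sub>R \<one>\<^sub>J) \<circ>\<^sub>J (1 *\<^sub>R \<one>\<^sub>J - (s - t) *\<^sub>R e) = (a - t *\<^sub>R \<one>\<^sub>J) - (s - t) *\<^sub>R ((a - t *\<^sub>R \<one>\<^sub>J) \<circ>\<^sub>J e)"
        by (simp add: jprod_diff_right jprod_scaleR_right)
      also have "\<dots> = a - s *\<^sub>R \<one>\<^sub>J"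
        by (simp add: e algebra_simps)
      finally have "(a - s *\<^sub>R \<one>\<^sub>J) \<circ>\<^sub>J (e \<circ>\<^sub>J y) = \<one>\<^sub>J"
        using jgen_prod_inverse[of "a - t *\<^sub>R \<one>\<^sub>J" a "1 *\<^sub>R \<one>\<^sub>J - (s - t) *\<^sub>R e" e y] e y
        by (simp add: jgen_algebra)
      then show False
        using in_jspectrumD[OF \<open>s \<in> jspectrum a\<close>] jgen_algebra(5)[OF e(1) y(1)] by blast
    qed
    then show "\<exists>\<epsilon>>0. \<forall>s. dist s t < \<epsilon> \<longrightarrow> s \<in> - jspectrum a"
      by (intro exI[of _ "1 / (norm e + 1)"]) (auto simp: add_nonneg_pos)
  qed
  then show ?thesis
    by (simp add: closed_def)
qed

lemma compact_jspectrum: "compact (jspectrum a)"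
proof -
  have "\<bar>t\<bar> \<le> norm a" if "t \<in> jspectrum a" for t
    using abs_poly_le_norm_jpoly[OF that, of "[:0, 1:]"] by simp
  then have "bounded (jspectrum a)"
    by (intro boundedI[of _ "norm a"]) auto
  then show ?thesis
    using closed_jspectrum by (simp add: compact_eq_bounded_closed)
qed

text \<open>The element \<open>(norm x)\<^sup>2 - x\<^sup>2\<close>, with \<open>x = p(a)\<close>, is not invertible, so the polynomial
  \<open>(norm x)\<^sup>2 - p\<^sup>2\<close> vanishes somewhere on the spectrum.\<close>

lemma norm_jpoly_attained_aux:
  assumes x: "jpoly p a \<noteq> 0" and nz: "[:(norm (jpoly p a))\<^sup>2:] - p * p \<noteq> 0"
  shows "\<exists>t\<in>jspectrum a. \<bar>poly p t\<bar> = norm (jpoly p a)"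
proof -
  let ?x = "jpoly p a" and ?q = "[:(norm (jpoly p a))\<^sup>2:] - p * p"
  have "jpoly ?q a = (norm ?x)\<^sup>2 *\<^sub>R \<one>\<^sub>J - ?x \<circ>\<^sub>J ?x"
    by (simp add: jpoly_diff jpoly_mult)
  then obtain t where t: "t \<in> jspectrum a" "poly ?q t = 0"
    using subalg_norm_not_invertible[OF opcomm_subalgebra_jgen jpoly_in_jgen x] jpoly_invertible[OF nz, of a]
    by metis
  then have "(norm ?x)\<^sup>2 = (poly p t)\<^sup>2"
    by (simp add: power2_eq_square)
  then have "\<bar>poly p t\<bar> = norm ?x"
    by (metis abs_norm_cancel real_sqrt_abs)
  then show ?thesis
    using t by blast
qed

text \<open>For nonzero \<open>a\<close> the identity polynomial qualifies in
  \<open>norm_jpoly_attained_aux\<close>, since (norm a)^2 - x^2 is not the zero polynomial.\<close>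

lemma jspectrum_nonempty:
  assumes "(\<one>\<^sub>J::'a::unital_jb_algebra) \<noteq> 0"
  shows "jspectrum (a::'a) \<noteq> {}"
proof (cases "a = 0")
  case True
  then have "0 \<in> jspectrum a"
    using assms by (simp add: jspectrum_def jinvertible_def is_jinverse_def)
  then show ?thesis
    by blast
next
  case False
  then show ?thesis
    using norm_jpoly_attained_aux[of "[:0, 1:]" a] by auto
qed

text \<open>What \<open>norm_jpoly_attained_aux\<close> leaves open is p(a) = 0 or p^2 constant;
  then any point of the spectrum serves.\<close>

lemma norm_jpoly_attained:
  assumes "(\<one>\<^sub>J::'a::unital_jb_algebra) \<noteq> 0"
  shows "\<exists>t\<in>jspectrum (a::'a). \<bar>poly p t\<bar> = norm (jpoly p a)"
proof -
  obtain t where t: "t \<in> jspectrum a"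
    using jspectrum_nonempty[OF assms] by blast
  consider "jpoly p a = 0" | "[:(norm (jpoly p a))\<^sup>2:] - p * p = 0"
    | "jpoly p a \<noteq> 0" "[:(norm (jpoly p a))\<^sup>2:] - p * p \<noteq> 0"
    by blast
  then show ?thesis
  proof cases
    case 1
    then show ?thesis
      using abs_poly_le_norm_jpoly[OF t, of p] t by (intro bexI[of _ t]) auto
  next
    case 2
    then have "poly ([:(norm (jpoly p a))\<^sup>2:] - p * p) t = 0"
      by simp
    then have "(norm (jpoly p a))\<^sup>2 = (poly p t)\<^sup>2"
      by (simp add: power2_eq_square)
    then have "\<bar>poly p t\<bar> = norm (jpoly p a)"
      by (metis abs_norm_cancel real_sqrt_abs)
    with t show ?thesis
      by blast
  next
    case 3
    then show ?thesis
      by (rule norm_jpoly_attained_aux)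
  qed
qed

section \<open>Continuous functional calculus\<close>

lemma real_polynomial_function_poly:
  fixes f :: "real \<Rightarrow> real"
  assumes "real_polynomial_function f"
  shows "\<exists>p. f = poly p"
  using assms
proof induction
  case (linear f)
  then obtain c where "f = (\<lambda>x. x * c)"
    using real_bounded_linear by blast
  then have "f = poly [:0, c:]"
    by auto
  then show ?case
    by blast
next
  case (const c)
  have "(\<lambda>x. c) = poly [:c:]"
    by auto
  then show ?case
    by blast
next
  case (add f g)
  then obtain p q where "f = poly p" "g = poly q"
    by blast
  then have "(\<lambda>x. f x + g x) = poly (p + q)"
    by auto
  then show ?case
    by blast
next
  case (mult f g)
  then obtain p q where "f = poly p" "g = poly q"
    by blast
  then have "(\<lambda>x. f x * g x) = poly (p * q)"
    by auto
  then show ?case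
    by blast
qed

lemma uniform_limit_poly:
  fixes f :: "real \<Rightarrow> real"
  assumes K: "compact K" and f: "continuous_on K f"
  obtains p where "uniform_limit K (\<lambda>n. poly (p n)) f sequentially"
proof -
  have "\<exists>p. \<forall>x\<in>K. \<bar>f x - poly p x\<bar> < inverse (real (Suc n))" for n
    using Stone_Weierstrass_real_polynomial_function[OF K f, of "inverse (real (Suc n))"]
      real_polynomial_function_poly by (metis inverse_positive_iff_positive of_nat_0_less_iff zero_less_Suc)
  then obtain p where p: "\<And>n x. x \<in> K \<Longrightarrow> \<bar>f x - poly (p n) x\<bar> < inverse (real (Suc n))"
    by metis
  have "uniform_limit K (\<lambda>n. poly (p n)) f sequentially"
  proof (rule uniform_limitI)
    fix e :: real assume "e > 0"
    then have "\<forall>\<^sub>F n in sequentially. inverse (real (Suc n)) < e"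
      using LIMSEQ_inverse_real_of_nat by (rule order_tendstoD(2)[rotated])
    then show "\<forall>\<^sub>F n in sequentially. \<forall>x\<in>K. dist (poly (p n) x) (f x) < e"
    proof eventually_elim
      case (elim n)
      show ?case
        using less_trans[OF p elim] by (metis dist_commute dist_real_def)
    qed
  qed
  then show ?thesis
    using that by blast
qed

text \<open>The graph of the calculus, made of limits of pairs (p, p(a)). In relational form the
  algebraic rules pass to the limit before existence and uniqueness are known.\<close>

definition jcfc_rel :: "'a::unital_jb_algebra \<Rightarrow> (real \<Rightarrow> real) \<Rightarrow> 'a \<Rightarrow> bool" where
  "jcfc_rel a f y \<longleftrightarrow> (\<exists>p. uniform_limit (jspectrum a) (\<lambda>n. poly (p n)) f sequentially \<and>
     (\<lambda>n. jpoly (p n) a) \<longlonglongrightarrow> y)"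

lemma jcfc_relE:
  assumes "jcfc_rel a f y"
  obtains p where "uniform_limit (jspectrum a) (\<lambda>n. poly (p n)) f sequentially"
    and "(\<lambda>n. jpoly (p n) a) \<longlonglongrightarrow> y"
  using assms by (auto simp: jcfc_rel_def)

lemma jcfc_rel_poly: "jcfc_rel a (poly p) (jpoly p a)"
  unfolding jcfc_rel_def by (intro exI[of _ "\<lambda>_. p"]) (simp add: uniform_limit_const)

lemma jcfc_rel_add:
  assumes "jcfc_rel a f y" "jcfc_rel a g z"
  shows "jcfc_rel a (\<lambda>x. f x + g x) (y + z)"
proof -
  obtain p q where
    "uniform_limit (jspectrum a) (\<lambda>n. poly (p n)) f sequentially" "(\<lambda>n. jpoly (p n) a) \<longlonglongrightarrow> y"
    "uniform_limit (jspectrum a) (\<lambda>n. poly (q n)) g sequentially" "(\<lambda>n. jpoly (q n) a) \<longlonglongrightarrow> z"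
    using assms jcfc_relE by metis
  moreover have "poly (p n + q n) = (\<lambda>x. poly (p n) x + poly (q n) x)" for n
    by auto
  ultimately show ?thesis
    unfolding jcfc_rel_def
    by (intro exI[of _ "\<lambda>n. p n + q n"]) (simp add: jpoly_add uniform_limit_add tendsto_add)
qed

lemma jcfc_rel_diff:
  assumes "jcfc_rel a f y" "jcfc_rel a g z"
  shows "jcfc_rel a (\<lambda>x. f x - g x) (y - z)"
proof -
  obtain p q where
    "uniform_limit (jspectrum a) (\<lambda>n. poly (p n)) f sequentially" "(\<lambda>n. jpoly (p n) a) \<longlonglongrightarrow> y"
    "uniform_limit (jspectrum a) (\<lambda>n. poly (q n)) g sequentially" "(\<lambda>n. jpoly (q n) a) \<longlonglongrightarrow> z"
    using assms jcfc_relE by metis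
  moreover have "poly (p n - q n) = (\<lambda>x. poly (p n) x - poly (q n) x)" for n
    by auto
  ultimately show ?thesis
    unfolding jcfc_rel_def
    by (intro exI[of _ "\<lambda>n. p n - q n"]) (simp add: jpoly_diff uniform_limit_minus tendsto_diff)
qed

lemma jcfc_rel_mult:
  assumes "jcfc_rel a f y" "jcfc_rel a g z"
    and "continuous_on (jspectrum a) f" "continuous_on (jspectrum a) g"
  shows "jcfc_rel a (\<lambda>x. f x * g x) (y \<circ>\<^sub>J z)"
proof -
  have "bounded (f ` jspectrum a)" "bounded (g ` jspectrum a)"
    using assms(3,4) compact_jspectrum by (auto intro!: compact_imp_bounded compact_continuous_image)
  moreover obtain p q where
    "uniform_limit (jspectrum a) (\<lambda>n. poly (p n)) f sequentially" "(\<lambda>n. jpoly (p n) a) \<longlonglongrightarrow> y"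
    "uniform_limit (jspectrum a) (\<lambda>n. poly (q n)) g sequentially" "(\<lambda>n. jpoly (q n) a) \<longlonglongrightarrow> z"
    using assms(1,2) jcfc_relE by metis
  moreover have "poly (p n * q n) = (\<lambda>x. poly (p n) x * poly (q n) x)" for n
    by auto
  ultimately show ?thesis
    unfolding jcfc_rel_def
    by (intro exI[of _ "\<lambda>n. p n * q n"]) (simp add: jpoly_mult uniform_lim_mult jprod.tendsto)
qed

lemma jcfc_rel_in_jgen: "jcfc_rel a f y \<Longrightarrow> y \<in> jgen a"
  by (elim jcfc_relE) (rule in_jgenI)

lemma jcfc_rel_bound:
  assumes "jcfc_rel a f y" "t \<in> jspectrum a"
  shows "\<bar>f t\<bar> \<le> norm y"
  using assms(1)
proof (rule jcfc_relE)
  fix p assume p: "uniform_limit (jspectrum a) (\<lambda>n. poly (p n)) f sequentially"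
    "(\<lambda>n. jpoly (p n) a) \<longlonglongrightarrow> y"
  show ?thesis
  proof (rule LIMSEQ_le)
    show "(\<lambda>n. \<bar>poly (p n) t\<bar>) \<longlonglongrightarrow> \<bar>f t\<bar>"
      using tendsto_uniform_limitI[OF p(1) assms(2)] by (rule tendsto_rabs)
    show "(\<lambda>n. norm (jpoly (p n) a)) \<longlonglongrightarrow> norm y"
      using p(2) by (rule tendsto_norm)
    show "\<exists>N. \<forall>n\<ge>N. \<bar>poly (p n) t\<bar> \<le> norm (jpoly (p n) a)"
      using abs_poly_le_norm_jpoly[OF assms(2)] by blast
  qed
qed

text \<open>Polynomials whose values at \<open>a\<close> converge to \<open>y\<close> are uniformly
  Cauchy on the spectrum by \<open>abs_poly_le_norm_jpoly\<close>; \<open>f\<close> is their limit.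
  This makes the calculus surjective onto the generated subalgebra.\<close>

lemma jgen_jcfc_rel:
  assumes "y \<in> jgen a"
  obtains f where "continuous_on (jspectrum a) f" "jcfc_rel a f y"
  using assms
proof (rule in_jgenE)
  fix p assume p: "(\<lambda>n. jpoly (p n) a) \<longlonglongrightarrow> y"
  have "uniformly_Cauchy_on (jspectrum a) (\<lambda>n. poly (p n))"
  proof (rule uniformly_Cauchy_onI)
    fix e :: real assume "e > 0"
    then obtain M where M: "dist (jpoly (p m) a) (jpoly (p n) a) < e" if "m \<ge> M" "n \<ge> M" for m n
      using LIMSEQ_imp_Cauchy[OF p] unfolding Cauchy_def by blast
    have "dist (poly (p m) t) (poly (p n) t) < e" if "t \<in> jspectrum a" "m \<ge> M" "n \<ge> M" for t m n
      using abs_poly_le_norm_jpoly[OF that(1), of "p m - p n"] M[OF that(2,3)]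
      by (simp add: dist_norm jpoly_diff)
    then show "\<exists>M. \<forall>t\<in>jspectrum a. \<forall>m\<ge>M. \<forall>n\<ge>M. dist (poly (p m) t) (poly (p n) t) < e"
      by blast
  qed
  then obtain f where f: "uniform_limit (jspectrum a) (\<lambda>n. poly (p n)) f sequentially"
    using Cauchy_uniformly_convergent unfolding uniformly_convergent_on_def by blast
  have "continuous_on (jspectrum a) f"
    by (rule uniform_limit_theorem[OF _ f]) (auto intro!: always_eventually continuous_intros)
  then show thesis
    using that f p unfolding jcfc_rel_def by blast
qed

text \<open>In the trivial algebra the spectrum is empty and the supremum in the isometry condition
  is a junk value, so the calculus is only available for \<open>\<one>\<^sub>J \<noteq> 0\<close>.\<close>

context
  assumes nontrivial: "(\<one>\<^sub>J::'a::unital_jb_algebra) \<noteq> 0"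
begin

lemma jcfc_rel_norm:
  assumes "jcfc_rel (a::'a) f y"
  shows "norm y = (SUP t\<in>jspectrum a. \<bar>f t\<bar>)"
proof (rule antisym)
  have bdd: "bdd_above ((\<lambda>t. \<bar>f t\<bar>) ` jspectrum a)"
    using jcfc_rel_bound[OF assms] by (intro bdd_aboveI[of _ "norm y"]) auto
  show "(SUP t\<in>jspectrum a. \<bar>f t\<bar>) \<le> norm y"
    using jspectrum_nonempty[OF nontrivial] jcfc_rel_bound[OF assms] by (intro cSUP_least)
  obtain p where p: "uniform_limit (jspectrum a) (\<lambda>n. poly (p n)) f sequentially"
    "(\<lambda>n. jpoly (p n) a) \<longlonglongrightarrow> y"
    using assms by (rule jcfc_relE)
  show "norm y \<le> (SUP t\<in>jspectrum a. \<bar>f t\<bar>)"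
  proof (rule field_le_epsilon)
    fix e :: real assume "e > 0"
    then have "\<forall>\<^sub>F n in sequentially. \<forall>t\<in>jspectrum a. dist (poly (p n) t) (f t) < e"
      using p(1) by (rule uniform_limitD[rotated])
    then have "\<forall>\<^sub>F n in sequentially. norm (jpoly (p n) a) \<le> (SUP t\<in>jspectrum a. \<bar>f t\<bar>) + e"
    proof eventually_elim
      case (elim n)
      obtain t where t: "t \<in> jspectrum a" "\<bar>poly (p n) t\<bar> = norm (jpoly (p n) a)"
        using norm_jpoly_attained[OF nontrivial] by blast
      have "\<bar>f t\<bar> \<le> (SUP t\<in>jspectrum a. \<bar>f t\<bar>)"
        using bdd t by (intro cSUP_upper)
      moreover have "\<bar>poly (p n) t - f t\<bar> < e"
        using elim t by (simp add: dist_real_def)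
      ultimately show ?case
        using t by linarith
    qed
    then show "norm y \<le> (SUP t\<in>jspectrum a. \<bar>f t\<bar>) + e"
      using tendsto_norm[OF p(2)] by (intro tendsto_upperbound) auto
  qed
qed

lemma jcfc_rel_unique:
  assumes "jcfc_rel (a::'a) f y" "jcfc_rel a f z"
  shows "y = z"
  using jcfc_rel_norm[OF jcfc_rel_diff[OF assms]] jspectrum_nonempty[OF nontrivial, of a] by simp

text \<open>Polynomials converging uniformly to \<open>f\<close> have values at \<open>a\<close>
  that form a Cauchy sequence, because the norm of each difference is attained on the
  spectrum.\<close>

lemma jcfc_rel_exists:
  assumes "continuous_on (jspectrum (a::'a)) f"
  shows "\<exists>y. jcfc_rel a f y"
proof -
  obtain p where p: "uniform_limit (jspectrum a) (\<lambda>n. poly (p n)) f sequentially"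
    using uniform_limit_poly[OF compact_jspectrum assms] .
  have "Cauchy (\<lambda>n. jpoly (p n) a)"
  proof (rule metric_CauchyI)
    fix e :: real assume "e > 0"
    then have "\<forall>\<^sub>F n in sequentially. \<forall>t\<in>jspectrum a. dist (poly (p n) t) (f t) < e / 2"
      using p by (intro uniform_limitD) auto
    then obtain M where M: "dist (poly (p n) t) (f t) < e / 2" if "n \<ge> M" "t \<in> jspectrum a" for n t
      unfolding eventually_sequentially by blast
    have "dist (jpoly (p m) a) (jpoly (p n) a) < e" if "m \<ge> M" "n \<ge> M" for m n
    proof -
      obtain t where t: "t \<in> jspectrum a" "\<bar>poly (p m - p n) t\<bar> = norm (jpoly (p m - p n) a)"
        using norm_jpoly_attained[OF nontrivial] by blast
      then show ?thesis
        using dist_triangle_half_l[OF M[OF that(1) t(1)] M[OF that(2) t(1)]]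
        by (simp add: dist_norm jpoly_diff)
    qed
    then show "\<exists>M. \<forall>m\<ge>M. \<forall>n\<ge>M. dist (jpoly (p m) a) (jpoly (p n) a) < e"
      by blast
  qed
  then show ?thesis
    using p unfolding jcfc_rel_def Cauchy_convergent_iff convergent_def by blast
qed

lemma is_functional_calculus_jcfc: "is_functional_calculus (a::'a) (\<lambda>f. jcfc f a)"
proof -
  define \<Phi> where "\<Phi> f = (SOME y. jcfc_rel a f y)" for f
  let ?C = "{f. continuous_on (jspectrum a) f}"
  have rel: "jcfc_rel a f (\<Phi> f)" if "f \<in> ?C" for f
    using that unfolding \<Phi>_def by (intro someI_ex[OF jcfc_rel_exists]) simp
  have eq: "\<Phi> f = y" if "jcfc_rel a f y" for f y
    unfolding \<Phi>_def by (rule some_equality) (use that jcfc_rel_unique in auto)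
  have const: "jcfc_rel a (\<lambda>x. c) (c *\<^sub>R \<one>\<^sub>J)" for c
  proof -
    have "poly [:c:] = (\<lambda>x. c)"
      by auto
    then show ?thesis
      using jcfc_rel_poly[of a "[:c:]"] by simp
  qed
  have "is_functional_calculus a \<Phi>"
    unfolding is_functional_calculus_def Let_def
  proof (intro conjI ballI allI)
    have "poly [:0, 1:] = (\<lambda>x::real. x)"
      by auto
    then show "\<Phi> (\<lambda>x. x) = a"
      using jcfc_rel_poly[of a "[:0, 1:]"] by (intro eq) simp
    show "\<Phi> (\<lambda>x. 1) = \<one>\<^sub>J"
      using const[of 1] by (intro eq) simp
    show "\<Phi> (\<lambda>x. f x + g x) = \<Phi> f + \<Phi> g" if "f \<in> ?C" "g \<in> ?C" for f g
      using that by (intro eq jcfc_rel_add rel)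
    show "\<Phi> (\<lambda>x. f x * g x) = \<Phi> f \<circ>\<^sub>J \<Phi> g" if "f \<in> ?C" "g \<in> ?C" for f g
      using that by (intro eq jcfc_rel_mult rel) auto
    show "\<Phi> (\<lambda>x. c * f x) = c *\<^sub>R \<Phi> f" if "f \<in> ?C" for c f
      using jcfc_rel_mult[OF const[of c] rel[OF that]] that by (intro eq) (simp add: jprod_linear)
    show "norm (\<Phi> f) = (SUP x\<in>jspectrum a. \<bar>f x\<bar>)" if "f \<in> ?C" for f
      using rel[OF that] by (rule jcfc_rel_norm)
    show "\<Phi> ` ?C = closed_jsubalgebra hull {a, \<one>\<^sub>J}"
      unfolding hull_eq_jgen
    proof safe
      show "\<Phi> f \<in> jgen a" if "continuous_on (jspectrum a) f" for f
        using jcfc_rel_in_jgen[OF rel[of f]] that by simp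
      fix y assume "y \<in> jgen a"
      then obtain f where "continuous_on (jspectrum a) f" "jcfc_rel a f y"
        by (rule jgen_jcfc_rel)
      then show "y \<in> \<Phi> ` ?C"
        using eq by blast
    qed
  qed
  \<comment> \<open>One witness is enough: \<open>jcfc\<close> is defined by choice and inherits the
    defining properties.\<close>
  then have "is_functional_calculus a (SOME \<Phi>. is_functional_calculus a \<Phi>)"
    by (rule someI[of "is_functional_calculus a"])
  then show ?thesis
    by (simp add: jcfc_def[abs_def])
qed

section \<open>Rules of the calculus at a fixed element\<close>

context
  fixes a :: 'a
begin

lemmas jcfc_props = is_functional_calculus_jcfc[of a, unfolded is_functional_calculus_def Let_def]

lemma jcfc_id: "jcfc (\<lambda>x. x) a = a"
  and jcfc_one: "jcfc (\<lambda>x. 1) a = \<one>\<^sub>J"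
  using jcfc_props by blast+

lemma jcfc_add: "continuous_on (jspectrum a) f \<Longrightarrow> continuous_on (jspectrum a) g \<Longrightarrow>
    jcfc (\<lambda>x. f x + g x) a = jcfc f a + jcfc g a"
  and jcfc_scaleR: "continuous_on (jspectrum a) f \<Longrightarrow> jcfc (\<lambda>x. c * f x) a = c *\<^sub>R jcfc f a"
  and jcfc_mult: "continuous_on (jspectrum a) f \<Longrightarrow> continuous_on (jspectrum a) g \<Longrightarrow>
    jcfc (\<lambda>x. f x * g x) a = jcfc f a \<circ>\<^sub>J jcfc g a"
  and norm_jcfc: "continuous_on (jspectrum a) f \<Longrightarrow> norm (jcfc f a) = (SUP x\<in>jspectrum a. \<bar>f x\<bar>)"
  using jcfc_props by auto

lemma jcfc_diff:
  assumes "continuous_on (jspectrum a) f" "continuous_on (jspectrum a) g"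
  shows "jcfc (\<lambda>x. f x - g x) a = jcfc f a - jcfc g a"
  using jcfc_add[of "\<lambda>x. f x - g x" g] assms by (simp add: continuous_on_diff)

lemma jcfc_const: "jcfc (\<lambda>x. c) a = c *\<^sub>R \<one>\<^sub>J"
  using jcfc_scaleR[of "\<lambda>x. 1" c] by (simp add: jcfc_one)

text \<open>By isometry the norm of the difference is the supremum of 0 over the spectrum;
  nonemptiness of the spectrum keeps this from being a default value.\<close>

lemma jcfc_cong:
  assumes f: "continuous_on (jspectrum a) f" and eq: "\<And>x. x \<in> jspectrum a \<Longrightarrow> f x = g x"
  shows "jcfc f a = jcfc g a"
proof -
  have g: "continuous_on (jspectrum a) g"
    using f eq by (simp cong: continuous_on_cong)
  have "norm (jcfc f a - jcfc g a) = (SUP x\<in>jspectrum a. \<bar>f x - g x\<bar>)"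
    using f g by (simp add: norm_jcfc continuous_on_diff flip: jcfc_diff)
  also have "\<dots> = (SUP x\<in>jspectrum a. 0)"
    using eq by (intro SUP_cong) auto
  also have "\<dots> = 0"
    using jspectrum_nonempty[OF nontrivial, of a] by simp
  finally show ?thesis
    by simp
qed

lemma is_jinverse_jcfc:
  assumes f: "continuous_on (jspectrum a) f" and nz: "\<And>x. x \<in> jspectrum a \<Longrightarrow> f x \<noteq> 0"
  shows "is_jinverse (jcfc f a) (jcfc (\<lambda>x. 1 / f x) a)"
proof -
  have g: "continuous_on (jspectrum a) (\<lambda>x. 1 / f x)"
    using f nz by (intro continuous_intros) auto
  have "jcfc (\<lambda>x. f x * (1 / f x)) a = jcfc (\<lambda>x. 1) a"
    using f g nz by (intro jcfc_cong continuous_on_mult) auto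
  moreover have "jcfc (\<lambda>x. (f x * f x) * (1 / f x)) a = jcfc f a"
    using f g nz by (intro jcfc_cong continuous_on_mult) auto
  moreover have "continuous_on (jspectrum a) (\<lambda>x. f x * f x)"
    using f by (intro continuous_intros)
  ultimately show ?thesis
    unfolding is_jinverse_def using f g by (metis jcfc_mult jcfc_one)
qed

text \<open>For negative \<mu> the function f - \<mu> has no zero on the spectrum of
  \<open>a\<close>, so \<open>is_jinverse_jcfc\<close> inverts f(a) - \<mu>.\<close>

lemma jpositive_jcfc:
  assumes f: "continuous_on (jspectrum a) f" and nn: "\<And>x. x \<in> jspectrum a \<Longrightarrow> f x \<ge> 0"
  shows "jpositive (jcfc f a)"
  unfolding jpositive_def
proof (rule ccontr)
  assume "\<not> jspectrum (jcfc f a) \<subseteq> {0..}"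
  then obtain \<mu> where \<mu>: "\<mu> \<in> jspectrum (jcfc f a)" "\<mu> < 0"
    by (metis atLeast_iff linorder_not_le subsetI)
  have "jcfc f a - \<mu> *\<^sub>R \<one>\<^sub>J = jcfc (\<lambda>x. f x - \<mu>) a"
    using f by (subst jcfc_diff) (auto simp: jcfc_const)
  moreover have "f x - \<mu> \<noteq> 0" if "x \<in> jspectrum a" for x
    using nn[OF that] \<mu> by simp
  ultimately have "jinvertible (jcfc f a - \<mu> *\<^sub>R \<one>\<^sub>J)"
    using is_jinverse_jcfc[of "\<lambda>x. f x - \<mu>"] f
    by (auto simp: jinvertible_def continuous_on_diff)
  then show False
    using \<mu> by (simp add: jspectrum_def)
qed

end

end


section \<open>Order\<close>

context
  assumes nontrivial: "(\<one>\<^sub>J::'a::unital_jb_algebra) \<noteq> 0"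
begin

text \<open>Together with \<open>norm_le_jpositive\<close> this turns positivity into a norm bound,
  so that \<open>jpositive_add\<close> becomes the triangle inequality.\<close>

lemma jpositive_norm_le:
  assumes a: "jpositive (a::'a)" and r: "norm a \<le> r"
  shows "norm (r *\<^sub>R \<one>\<^sub>J - a) \<le> r"
proof -
  have "r *\<^sub>R \<one>\<^sub>J - a = jcfc (\<lambda>x. r - x) a"
    by (simp add: jcfc_diff[OF nontrivial] jcfc_const[OF nontrivial] jcfc_id[OF nontrivial])
  then have "norm (r *\<^sub>R \<one>\<^sub>J - a) = (SUP x\<in>jspectrum a. \<bar>r - x\<bar>)"
    by (simp add: norm_jcfc[OF nontrivial] continuous_on_diff)
  also have "\<dots> \<le> r"
  proof (rule cSUP_least)
    fix x assume x: "x \<in> jspectrum a"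
    then have "x \<ge> 0"
      using a by (auto simp: jpositive_def)
    moreover have "\<bar>x\<bar> \<le> norm a"
      using abs_poly_le_norm_jpoly[OF x, of "[:0, 1:]"] by simp
    ultimately show "\<bar>r - x\<bar> \<le> r"
      using r by simp
  qed (rule jspectrum_nonempty[OF nontrivial])
  finally show ?thesis .
qed

lemma norm_le_jpositive:
  assumes "norm (r *\<^sub>R \<one>\<^sub>J - (a::'a)) \<le> r"
  shows "jpositive a"
proof -
  have "t \<ge> 0" if "t \<in> jspectrum a" for t
    using abs_poly_le_norm_jpoly[OF that, of "[:r, -1:]"] assms by (simp add: jprod_linear)
  then show ?thesis
    by (auto simp: jpositive_def)
qed

lemma jpositive_add:
  assumes "jpositive (a::'a)" "jpositive b"
  shows "jpositive (a + b)"
proof (rule norm_le_jpositive)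
  have "norm ((norm a *\<^sub>R \<one>\<^sub>J - a) + (norm b *\<^sub>R \<one>\<^sub>J - b)) \<le> norm a + norm b"
    using assms by (intro norm_triangle_mono jpositive_norm_le) auto
  then show "norm ((norm a + norm b) *\<^sub>R \<one>\<^sub>J - (a + b)) \<le> norm a + norm b"
    by (simp add: algebra_simps)
qed

lemma jpositive_square: "jpositive (a \<circ>\<^sub>J (a::'a))"
proof -
  have "jpositive (jcfc (\<lambda>x. x * x) a)"
    by (intro jpositive_jcfc[OF nontrivial] continuous_intros) auto
  then show ?thesis
    by (simp add: jcfc_mult[OF nontrivial] jcfc_id[OF nontrivial])
qed

lemma jspectrum_pos:
  assumes "jpositive (a::'a)" "jinvertible a" "x \<in> jspectrum a"
  shows "x > 0"
  using assms by (cases "x = 0") (auto simp: jpositive_def jspectrum_def)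

text \<open>With \<delta> > 0 the least point of the spectrum of \<open>b\<close>, the sum a + (b -
  \<delta>) is positive. So -\<delta> lies outside its spectrum, and adding \<delta> back leaves an
  invertible element.\<close>

lemma jinvertible_jpositive_add:
  assumes a: "jpositive (a::'a)" and b: "jpositive b" "jinvertible b"
  shows "jinvertible (a + b)"
proof -
  obtain \<delta> where \<delta>: "\<delta> \<in> jspectrum b" "\<And>x. x \<in> jspectrum b \<Longrightarrow> \<delta> \<le> x"
    using compact_attains_inf[OF compact_jspectrum jspectrum_nonempty[OF nontrivial]] by blast
  have "b - \<delta> *\<^sub>R \<one>\<^sub>J = jcfc (\<lambda>x. x - \<delta>) b"
    by (simp add: jcfc_diff[OF nontrivial] jcfc_const[OF nontrivial] jcfc_id[OF nontrivial])
  also have "jpositive \<dots>"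
    using \<delta> by (intro jpositive_jcfc[OF nontrivial] continuous_intros) auto
  finally have "jpositive (a + (b - \<delta> *\<^sub>R \<one>\<^sub>J))"
    by (rule jpositive_add[OF a])
  then have "- \<delta> \<notin> jspectrum (a + (b - \<delta> *\<^sub>R \<one>\<^sub>J))"
    using jspectrum_pos[OF b \<delta>(1)] by (auto simp: jpositive_def)
  then show ?thesis
    by (simp add: jspectrum_def algebra_simps)
qed

text \<open>For \<open>\<mu> > 0\<close> we have \<open>{a b a} + \<mu> = {a (b + \<mu> a'\<^sup>2) a}\<close>, which is invertible.\<close>

lemma jpositive_jtriple:
  assumes a: "is_jinverse a a'" and b: "jpositive (b::'a)"
  shows "jpositive (jtriple a b)"
proof -
  have "jinvertible (jtriple a b - \<mu> *\<^sub>R \<one>\<^sub>J)" if \<mu>: "\<mu> < 0" for \<mu>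
  proof -
    define r where "r = sqrt (- \<mu>)"
    have r: "r \<noteq> 0" "r * r = - \<mu>"
      using \<mu> by (simp_all add: r_def)
    \<comment> \<open>Here \<mu> is negative, and {a c^2 a} = r^2 {a a'^2 a} = -\<mu>.\<close>
    define c where "c = r *\<^sub>R a'"
    have "is_jinverse c ((1 / r) *\<^sub>R a)"
      using is_jinverse_sym[OF a] r(1) by (simp add: c_def is_jinverse_def jprod_linear)
    then have "jinvertible (c \<circ>\<^sub>J c)"
      using is_jinverse_jtriple[of c _ "\<one>\<^sub>J" "\<one>\<^sub>J"] by (auto simp: jinvertible_def is_jinverse_def)
    then have "jinvertible (b + c \<circ>\<^sub>J c)"
      by (rule jinvertible_jpositive_add[OF b jpositive_square])
    moreover have "jtriple a (c \<circ>\<^sub>J c) = (- \<mu>) *\<^sub>R \<one>\<^sub>J"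
      using r(2) is_jinverse_jtriple_square[OF a] jtriple_linear(3)[of a "- \<mu>" "a' \<circ>\<^sub>J a'"]
      by (simp add: c_def jprod_linear)
    ultimately have "jtriple a (b + c \<circ>\<^sub>J c) = jtriple a b - \<mu> *\<^sub>R \<one>\<^sub>J"
      by (simp add: jtriple_linear)
    with \<open>jinvertible (b + c \<circ>\<^sub>J c)\<close> show ?thesis
      using is_jinverse_jtriple[OF a] by (metis jinvertible_def)
  qed
  then show ?thesis
    unfolding jpositive_def jspectrum_def by (auto simp: not_less[symmetric])
qed

section \<open>Means\<close>

lemma powr_le_weighted_mean:
  fixes s t :: real
  assumes "s > 0" "0 \<le> t" "t \<le> 1"
  shows "s powr t \<le> (1 - t) + t * s"
  using Youngs_inequality_0[of "1 - t" t 1 s] assms by simp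

text \<open>The preceding inequality at 1 / s, inverted.\<close>

lemma weighted_harmonic_mean_le_powr:
  fixes s t :: real
  assumes "s > 0" "0 \<le> t" "t \<le> 1"
  shows "1 / ((1 - t) + t * (1 / s)) \<le> s powr t"
proof -
  have "(1 / s) powr t \<le> (1 - t) + t * (1 / s)"
    using assms by (intro powr_le_weighted_mean) auto
  moreover have "(1 / s) powr t = 1 / s powr t"
    using assms by (simp add: powr_divide)
  ultimately show ?thesis
    using assms
    by (metis divide_le_eq_1_pos inverse_eq_divide inverse_inverse_eq le_imp_inverse_le powr_gt_zero zero_less_divide_1_iff less_irrefl)
qed

theorem mean_inequalities:
  fixes A B :: 'a and t :: real
  assumes A: "jpositive A" "jinvertible A" and B: "jpositive B" "jinvertible B"
    and t: "0 \<le> t" "t \<le> 1"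
  shows "harmonic_mean t A B \<le>\<^sub>J geometric_mean t A B \<and>
         geometric_mean t A B \<le>\<^sub>J arithmetic_mean t A B"
proof -
  have powr_cont: "continuous_on (jspectrum D) (\<lambda>x. x powr p)"
    if "jpositive D" "jinvertible D" for D :: 'a and p
    using jspectrum_pos[OF that] by (intro continuous_intros) auto
  define X Y where "X = jpowr A (1/2)" and "Y = jpowr A (- 1/2)"
  have "jcfc (\<lambda>x. 1 / x powr (1/2)) A = Y"
    unfolding Y_def jpowr_def using powr_cont[OF A, of "1/2"] jspectrum_pos[OF A]
    by (intro jcfc_cong[OF nontrivial] continuous_intros) (force simp: powr_minus_divide)+
  moreover have "is_jinverse (jcfc (\<lambda>x. x powr (1/2)) A) (jcfc (\<lambda>x. 1 / x powr (1/2)) A)"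
    using powr_cont[OF A] jspectrum_pos[OF A] by (intro is_jinverse_jcfc[OF nontrivial]) force+
  ultimately have XY: "is_jinverse X Y"
    by (simp add: X_def jpowr_def)
  have "X \<circ>\<^sub>J X = jcfc (\<lambda>x. x powr (1/2) * x powr (1/2)) A"
    using powr_cont[OF A] by (simp add: jcfc_mult[OF nontrivial] X_def jpowr_def)
  also have "\<dots> = jcfc (\<lambda>x. x) A"
  proof (rule jcfc_cong[OF nontrivial])
    show "continuous_on (jspectrum A) (\<lambda>x. x powr (1/2) * x powr (1/2))"
      using powr_cont[OF A] by (intro continuous_on_mult)
    show "x powr (1/2) * x powr (1/2) = x" if "x \<in> jspectrum A" for x
      using jspectrum_pos[OF A that] by (simp flip: powr_add)
  qed
  finally have XX: "X \<circ>\<^sub>J X = A"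
    by (simp add: jcfc_id[OF nontrivial])
  define C where "C = jtriple Y B"
  have XC: "jtriple X C = B"
    by (simp add: C_def is_jinverse_jtriple_cancel[OF XY])
  have one: "is_jinverse \<one>\<^sub>J (\<one>\<^sub>J::'a)"
    by (simp add: is_jinverse_def)
  have "is_jinverse A (Y \<circ>\<^sub>J Y)"
    using is_jinverse_jtriple[OF XY one] by (simp add: XX)
  then have invA: "jinverse A = Y \<circ>\<^sub>J Y"
    by (rule jinverse_eq)
  define C' where "C' = jtriple X (jinverse B)"
  have CC': "is_jinverse C C'"
    unfolding C_def C'_def by (intro is_jinverse_jtriple is_jinverse_jinverse B is_jinverse_sym[OF XY])
  have C: "jpositive C" "jinvertible C"
    using CC' jpositive_jtriple[OF is_jinverse_sym[OF XY] B(1)] by (auto simp: C_def jinvertible_def)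
  have G: "geometric_mean t A B = jtriple X (jcfc (\<lambda>s. s powr t) C)"
    by (simp add: geometric_mean_def X_def Y_def C_def jpowr_def)
  have C_pos: "s > 0" if "s \<in> jspectrum C" for s
    using jspectrum_pos[OF C that] .

  \<comment> \<open>The reciprocal of \<open>g s\<close> is the scalar weighted harmonic mean of 1
    and \<open>s\<close>.\<close>
  define g where "g s = (1 - t) + t * (1 / s)" for s
  have g_pos: "g s > 0" if "s > 0" for s
    using t that unfolding g_def by (cases "t = 0") (auto intro: add_nonneg_pos)
  have inv_cont: "continuous_on (jspectrum C) (\<lambda>s. 1 / s)"
    using C_pos by (intro continuous_intros) force
  have g_cont: "continuous_on (jspectrum C) g"
    unfolding g_def by (intro continuous_intros inv_cont)
  have ginv_cont: "continuous_on (jspectrum C) (\<lambda>s. 1 / g s)"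
    using g_pos C_pos by (intro continuous_intros g_cont) force
  have "C' = jcfc (\<lambda>s. 1 / s) C"
    using is_jinverse_jcfc[OF nontrivial, of C "\<lambda>s. s"] C_pos is_jinverse_unique[OF CC']
    by (force simp: jcfc_id[OF nontrivial])
  then have "jcfc g C = (1 - t) *\<^sub>R \<one>\<^sub>J + t *\<^sub>R C'"
    unfolding g_def
    using inv_cont jcfc_add[OF nontrivial, of C "\<lambda>s. 1 - t" "\<lambda>s. t * (1 / s)"]
      jcfc_scaleR[OF nontrivial inv_cont, of t]
    by (simp add: jcfc_const[OF nontrivial] continuous_on_mult_left del: mult_1_right times_divide_eq_right)
  moreover have "jtriple Y C' = jinverse B"
    by (simp add: C'_def is_jinverse_jtriple_cancel[OF XY])
  \<comment> \<open>U_Y sends 1 to the inverse of \<open>A\<close> and C' to the inverse of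
    \<open>B\<close>, so U_Y g(C) is the element that the harmonic mean inverts.\<close>
  ultimately have "jtriple Y (jcfc g C) = (1 - t) *\<^sub>R jinverse A + t *\<^sub>R jinverse B"
    by (simp add: jtriple_linear invA)
  moreover have "is_jinverse (jtriple Y (jcfc g C)) (jtriple X (jcfc (\<lambda>s. 1 / g s) C))"
    using g_pos C_pos
    by (intro is_jinverse_jtriple is_jinverse_jcfc[OF nontrivial] g_cont is_jinverse_sym[OF XY]) force
  ultimately have H: "harmonic_mean t A B = jtriple X (jcfc (\<lambda>s. 1 / g s) C)"
    by (simp add: harmonic_mean_def jinverse_eq)
  have "jpositive (jcfc (\<lambda>s. s powr t - 1 / g s) C)"
    using weighted_harmonic_mean_le_powr[OF C_pos t] powr_cont[OF C] ginv_cont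
    by (intro jpositive_jcfc[OF nontrivial] continuous_on_diff) (auto simp: g_def)
  then have "harmonic_mean t A B \<le>\<^sub>J geometric_mean t A B"
    using jpositive_jtriple[OF XY] powr_cont[OF C] ginv_cont
    by (simp add: jle_def G H jcfc_diff[OF nontrivial] flip: jtriple_linear)

  moreover have "jcfc (\<lambda>s. ((1 - t) + t * s) - s powr t) C
      = ((1 - t) *\<^sub>R \<one>\<^sub>J + t *\<^sub>R C) - jcfc (\<lambda>s. s powr t) C"
    using powr_cont[OF C]
    by (simp add: jcfc_diff[OF nontrivial] jcfc_add[OF nontrivial] jcfc_scaleR[OF nontrivial]
        jcfc_const[OF nontrivial] jcfc_id[OF nontrivial] continuous_on_add continuous_on_mult_left)
  moreover have "jpositive (jcfc (\<lambda>s. ((1 - t) + t * s) - s powr t) C)"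
    using powr_le_weighted_mean[OF C_pos t] powr_cont[OF C]
    by (intro jpositive_jcfc[OF nontrivial] continuous_on_diff continuous_on_add
        continuous_on_mult_left continuous_on_const continuous_on_id) auto
  \<comment> \<open>This uses A = U_X 1 and B = U_X C.\<close>
  moreover have "arithmetic_mean t A B = jtriple X ((1 - t) *\<^sub>R \<one>\<^sub>J + t *\<^sub>R C)"
    by (simp add: arithmetic_mean_def jtriple_linear XX XC)
  ultimately show ?thesis
    using jpositive_jtriple[OF XY] by (simp add: jle_def G flip: jtriple_linear(2))
qed

end

theorem theorem3:
  fixes A B :: "'a::unital_jb_algebra" and t :: real
  assumes "jpositive A" and "jinvertible A"
    and "jpositive B" and "jinvertible B"
    and "0 \<le> t" and "t \<le> 1"
  shows "harmonic_mean t A B \<le>\<^sub>J geometric_mean t A B \<and>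
         geometric_mean t A B \<le>\<^sub>J arithmetic_mean t A B"
proof (cases "(\<one>\<^sub>J::'a) = 0")
  \<comment> \<open>In the one-element algebra every element is invertible, so every spectrum is
    empty and every order relation holds.\<close>
  case True
  then have "x = 0" for x :: 'a
    by (metis jprod_jone_left jprod_zero(1))
  then have "x = y" for x y :: 'a
    by metis
  then have "jinvertible x" for x :: 'a
    unfolding jinvertible_def is_jinverse_def by blast
  then show ?thesis
    by (simp add: jle_def jpositive_def jspectrum_def)
next
  case False
  then show ?thesis
    using assms by (rule mean_inequalities)
qed

end
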